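(* Suppose that the system $y(t+1)=f(y(t),u(t),\sigma(t))$ satisfies the strong $h$-approximation conditions for every vector function $h=(q_1,\dots,q_j)$, $j=1,2,\dots$. For each such $h$ let $V_h\subset\mathbb R^j$ be the convex and compact set (which exists under these conditions) such that $d_H(V_h(T,y_0),V_h)\le\nu_h'(T)$ for all $y_0\in Y$, for some $\nu'_h$ with $\lim_{T\to\infty}\nu'_h(T)=0$, and let $$\Gamma=\Big\{\gamma\in\mathcal P(Y\times\hat U)\ \Big|\ \int_{Y\times\hat U}h(y,u)\,\gamma(dy,du)\in V_h\ \text{ for every } h=(q_1,\dots,q_j),\ j=1,2,\dots\Big\}.$$ Then there is a function $\bar\nu(T)$ with $\lim_{T\to\infty}\bar\nu(T)=0$ such that $$\sup_{\gamma\in\Gamma}\rho^E(\gamma,B_T(y_0))\le\bar\nu(T)\qquad\text{for every initial condition }y_0\in Y.$$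
   Context: Setting. $Y\subset\mathbb R^m$ is compact, $\hat U$ and $S$ are compact metric spaces, $f:Y\times\hat U\times S\to\mathbb R^m$ is continuous, and $f(y,u,\sigma)\in Y$ for all $(y,u,\sigma)\in Y\times\hat U\times S$. $\sigma(0),\sigma(1),\dots$ are independent, identically distributed random elements of $S$ on a common probability space. The system is $y(t+1)=f(y(t),u(t),\sigma(t))$, $y(0)=y_0\in Y$, $t=0,1,2,\dots$. A control plan is a sequence $\pi=\{\pi_t\}_{t\ge0}$ with $\pi_0\in\hat U$ and $\pi_t:S^t\to\hat U$ Borel measurable for $t\ge1$; the controls are $u(0)=\pi_0$, $u(t)=\pi_t(\sigma(0),\dots,\sigma(t-1))$. $\Pi$ is the set of all control plans, and $(y^{\pi,y_0}(\cdot),u^{\pi,y_0}(\cdot))$ is the resulting state-control trajectory. Occupational measures. $\mathcal P(Y\times\hat U)$ is the set of Borel probability measures on $Y\times\hat U$. For a positive integer $T$ and Borel $Q\subset Y\times\hat U$, the random occupational measure is $\chi^{\pi,y_0,T}(Q)=\frac1T\sum_{t=0}^{T-1}1_Q(y^{\pi,y_0}(t),u^{\pi,y_0}(t))$, and $\gamma^{\pi,y_0,T}(Q)=E[\chi^{\pi,y_0,T}(Q)]$. $B_T(y_0)=\bigcup_{\pi\in\Pi}\{\chi^{\pi,y_0,T}\}$ and $\Gamma_T(y_0)=\bigcup_{\pi\in\Pi}\{\gamma^{\pi,y_0,T}\}$. Metrics. $q_1,q_2,\dots$ is a fixed sequence of Lipschitz continuous functions dense in the unit ball of $C(Y\times\hat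 U)$. $\rho(\gamma',\gamma'')=\sum_{j\ge1}2^{-j}\big|\int q_j\,d\gamma'-\int q_j\,d\gamma''\big|$. For a deterministic $\gamma\in\mathcal P(Y\times\hat U)$ and a collection $\Phi$ of random probability measures on $Y\times\hat U$, $\rho^E(\gamma,\Phi)=\inf_{\gamma'\in\Phi}E[\rho(\gamma,\gamma')]$. $d_H$ is the Hausdorff distance between bounded subsets of $\mathbb R^j$ with the Euclidean norm. For $h=(q_1,\dots,q_j):Y\times\hat U\to\mathbb R^j$ put $V_h(T,y_0)=\big\{\int h\,d\gamma:\gamma\in\Gamma_T(y_0)\big\}\subset\mathbb R^j$. Strong $h$-approximation conditions (for a given $h$): there is a monotone decreasing $\nu_h:[0,\infty)\to[0,\infty)$ with $\lim_{T\to\infty}\nu_h(T)=0$ such that for all $T$, all $y_0',y_0''\in Y$ and every control plan $\pi'$ there is a control plan $\pi''$ with $E\Big[\Big\|\frac1T\sum_{t=0}^{T}h(y^{\pi',y_0'}(t),u^{\pi',y_0'}(t))-\frac1T\sum_{t=0}^{T}h(y^{\pi'',y_0''}(t),u^{\pi'',y_0''}(t))\Big\|\Big]\le\nu_h(T)$. *)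

theory Defs
  imports "HOL-Analysis.Analysis" "HOL-Probability.Probability"
begin

text \<open>
  A noise path is a function \<open>s :: nat \<Rightarrow> 's\<close>. A point of \<open>S\<^sup>t\<close> is represented as an
  extensional function on \<open>{..<t}\<close>, and \<open>S\<^sup>t\<close> carries the product of the Borel
  sigma-algebras. For a compact (hence second countable) metric space \<open>S\<close> this is
  the Borel sigma-algebra of \<open>S\<^sup>t\<close>. The space \<open>S\<^sup>0\<close> has exactly one point, so the condition
  for \<open>t = 0\<close> says that \<open>\<pi> 0\<close> is an element of \<open>U\<close>.
\<close>

definition control_plans ::
  "'u::metric_space set \<Rightarrow> 's::metric_space set \<Rightarrow> (nat \<Rightarrow> (nat \<Rightarrow> 's) \<Rightarrow> 'u) set" where
  "control_plans U S =
     {\<pi>. \<forall>t. \<pi> t \<in> (\<Pi>\<^sub>M i\<in>{..<t}. restrict_space borel S) \<rightarrow>\<^sub>M restrict_space borel U}"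

definition control :: "(nat \<Rightarrow> (nat \<Rightarrow> 's) \<Rightarrow> 'u) \<Rightarrow> (nat \<Rightarrow> 's) \<Rightarrow> nat \<Rightarrow> 'u" where
  "control \<pi> s t = \<pi> t (restrict s {..<t})"

primrec state ::
  "('y \<times> 'u \<times> 's \<Rightarrow> 'y) \<Rightarrow> (nat \<Rightarrow> (nat \<Rightarrow> 's) \<Rightarrow> 'u) \<Rightarrow> 'y \<Rightarrow> (nat \<Rightarrow> 's) \<Rightarrow> nat \<Rightarrow> 'y" where
  "state f \<pi> y0 s 0 = y0"
| "state f \<pi> y0 s (Suc t) = f (state f \<pi> y0 s t, control \<pi> s t, s t)"

definition trajectory ::
  "('y \<times> 'u \<times> 's \<Rightarrow> 'y) \<Rightarrow> (nat \<Rightarrow> (nat \<Rightarrow> 's) \<Rightarrow> 'u) \<Rightarrow> 'y \<Rightarrow> (nat \<Rightarrow> 's) \<Rightarrow> nat \<Rightarrow> 'y \<times> 'u" where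
  "trajectory f \<pi> y0 s t = (state f \<pi> y0 s t, control \<pi> s t)"

definition borel_prob_measures :: "'z::topological_space set \<Rightarrow> 'z measure set" where
  "borel_prob_measures K = {\<gamma>. sets \<gamma> = sets (restrict_space borel K) \<and> prob_space \<gamma>}"

definition empirical_measure ::
  "'z::topological_space set \<Rightarrow> nat \<Rightarrow> (nat \<Rightarrow> 'z) \<Rightarrow> 'z measure" where
  "empirical_measure K T z =
     measure_of K (sets (restrict_space borel K))
       (\<lambda>Q. ennreal (1 / real T * (\<Sum>t<T. indicator Q (z t))))"

lemma empirical_measure_eq_distr:
  assumes "0 < T" and z: "\<And>t. t < T \<Longrightarrow> z t \<in> K"
  shows "empirical_measure K T z =
    distr (uniform_count_measure {..<T}) (restrict_space borel K) z"
proof -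
  have meas: "z \<in> uniform_count_measure {..<T} \<rightarrow>\<^sub>M restrict_space borel K"
    using z by (auto simp: measurable_def sets_uniform_count_measure space_uniform_count_measure
        space_restrict_space)
  have em: "emeasure (distr (uniform_count_measure {..<T}) (restrict_space borel K) z) Q =
      ennreal (1 / real T * (\<Sum>t<T. indicator Q (z t)))"
    if "Q \<in> sets (restrict_space borel K)" for Q
  proof -
    have "real (card (z -` Q \<inter> {..<T})) = (\<Sum>t<T. indicator Q (z t))"
      by (simp add: indicator_def sum.If_cases vimage_def Int_def conj_commute)
    then show ?thesis
      using that meas \<open>0 < T\<close>
      by (simp add: emeasure_distr space_uniform_count_measure emeasure_uniform_count_measure)
  qed
  have K: "space (restrict_space borel K) = K"
    by (simp add: space_restrict_space)
  show ?thesis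
    unfolding empirical_measure_def
    using measure_of_of_measure[of "distr (uniform_count_measure {..<T}) (restrict_space borel K) z"]
    by (smt (verit) K em measure_of_eq sets.sigma_sets_eq sets_distr space_distr
        sets.space_closed)
qed

lemma prob_space_empirical_measure:
  assumes "0 < T" and "\<And>t. t < T \<Longrightarrow> z t \<in> K"
  shows "empirical_measure K T z \<in> borel_prob_measures K"
proof -
  have "z \<in> uniform_count_measure {..<T} \<rightarrow>\<^sub>M restrict_space borel K"
    using assms by (auto simp: measurable_def sets_uniform_count_measure
        space_uniform_count_measure space_restrict_space)
  moreover have "prob_space (uniform_count_measure {..<T})"
    using \<open>0 < T\<close> by (intro prob_space_uniform_count_measure) auto
  ultimately show ?thesis
    using assms
    by (simp add: empirical_measure_eq_distr borel_prob_measures_def prob_space.prob_space_distr)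
qed

definition random_occ_measure ::
  "'y::topological_space set \<Rightarrow> 'u::topological_space set \<Rightarrow> ('y \<times> 'u \<times> 's \<Rightarrow> 'y) \<Rightarrow>
   (nat \<Rightarrow> 'w \<Rightarrow> 's) \<Rightarrow> (nat \<Rightarrow> (nat \<Rightarrow> 's) \<Rightarrow> 'u) \<Rightarrow> 'y \<Rightarrow> nat \<Rightarrow> 'w \<Rightarrow> ('y \<times> 'u) measure" where
  "random_occ_measure Y U f \<sigma> \<pi> y0 T \<omega> =
     empirical_measure (Y \<times> U) T (trajectory f \<pi> y0 (\<lambda>i. \<sigma> i \<omega>))"

definition expected_occ_measure ::
  "'y::topological_space set \<Rightarrow> 'u::topological_space set \<Rightarrow> ('y \<times> 'u \<times> 's \<Rightarrow> 'y) \<Rightarrow>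
   'w measure \<Rightarrow> (nat \<Rightarrow> 'w \<Rightarrow> 's) \<Rightarrow> (nat \<Rightarrow> (nat \<Rightarrow> 's) \<Rightarrow> 'u) \<Rightarrow> 'y \<Rightarrow> nat \<Rightarrow> ('y \<times> 'u) measure" where
  "expected_occ_measure Y U f M \<sigma> \<pi> y0 T =
     measure_of (Y \<times> U) (sets (restrict_space borel (Y \<times> U)))
       (\<lambda>Q. ennreal (\<integral>\<omega>. measure (random_occ_measure Y U f \<sigma> \<pi> y0 T \<omega>) Q \<partial>M))"

definition random_occ_set ::
  "'y::topological_space set \<Rightarrow> 'u::metric_space set \<Rightarrow> 's::metric_space set \<Rightarrow>
   ('y \<times> 'u \<times> 's \<Rightarrow> 'y) \<Rightarrow> (nat \<Rightarrow> 'w \<Rightarrow> 's) \<Rightarrow> nat \<Rightarrow> 'y \<Rightarrow> ('w \<Rightarrow> ('y \<times> 'u) measure) set" where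
  "random_occ_set Y U S f \<sigma> T y0 =
     (\<lambda>\<pi>. random_occ_measure Y U f \<sigma> \<pi> y0 T) ` control_plans U S"

definition expected_occ_set ::
  "'y::topological_space set \<Rightarrow> 'u::metric_space set \<Rightarrow> 's::metric_space set \<Rightarrow>
   ('y \<times> 'u \<times> 's \<Rightarrow> 'y) \<Rightarrow> 'w measure \<Rightarrow> (nat \<Rightarrow> 'w \<Rightarrow> 's) \<Rightarrow> nat \<Rightarrow> 'y \<Rightarrow> ('y \<times> 'u) measure set" where
  "expected_occ_set Y U S f M \<sigma> T y0 =
     (\<lambda>\<pi>. expected_occ_measure Y U f M \<sigma> \<pi> y0 T) ` control_plans U S"

text \<open>The sequence \<open>q\<^sub>1, q\<^sub>2, \<dots>\<close> is indexed from 0, so \<open>q i\<close> stands for \<open>q\<^sub>i\<^sub>+\<^sub>1\<close>.\<close>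

definition lipschitz_dense_in_unit_ball ::
  "'z::metric_space set \<Rightarrow> (nat \<Rightarrow> 'z \<Rightarrow> real) \<Rightarrow> bool" where
  "lipschitz_dense_in_unit_ball K q \<longleftrightarrow>
     (\<forall>i. (\<exists>L. L-lipschitz_on K (q i)) \<and> (\<forall>z\<in>K. \<bar>q i z\<bar> \<le> 1)) \<and>
     (\<forall>g. continuous_on K g \<and> (\<forall>z\<in>K. \<bar>g z\<bar> \<le> 1) \<longrightarrow>
        (\<forall>\<epsilon>>0. \<exists>i. \<forall>z\<in>K. \<bar>q i z - g z\<bar> < \<epsilon>))"

definition rho :: "(nat \<Rightarrow> 'z \<Rightarrow> real) \<Rightarrow> 'z measure \<Rightarrow> 'z measure \<Rightarrow> real" where
  "rho q \<gamma>' \<gamma>'' = (\<Sum>i. (1/2) ^ Suc i * \<bar>(\<integral>z. q i z \<partial>\<gamma>') - (\<integral>z. q i z \<partial>\<gamma>'')\<bar>)"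

definition rho_E ::
  "(nat \<Rightarrow> 'z \<Rightarrow> real) \<Rightarrow> 'w measure \<Rightarrow> 'z measure \<Rightarrow> ('w \<Rightarrow> 'z measure) set \<Rightarrow> ennreal" where
  "rho_E q M \<gamma> \<Phi> = (INF X\<in>\<Phi>. ennreal (\<integral>\<omega>. rho q \<gamma> (X \<omega>) \<partial>M))"

text \<open>
  Since \<open>j\<close> is quantified inside the statement, \<open>\<real>\<^sup>j\<close> is the topological space
  \<^term>\<open>Euclidean_space j\<close>, whose points are the functions \<open>nat \<Rightarrow> real\<close>
  vanishing at all indices \<open>\<ge> j\<close>.
\<close>

definition vnorm :: "nat \<Rightarrow> (nat \<Rightarrow> real) \<Rightarrow> real" where
  "vnorm j x = L2_set x {..<j}"

definition convex_vectors :: "(nat \<Rightarrow> real) set \<Rightarrow> bool" where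
  "convex_vectors A \<longleftrightarrow>
     (\<forall>x\<in>A. \<forall>y\<in>A. \<forall>c\<in>{0..1}. (\<lambda>i. (1 - c) * x i + c * y i) \<in> A)"

text \<open>
  Valued in \<open>ennreal\<close>, so that no convention for real infima and suprema of empty or
  unbounded sets enters; on nonempty bounded sets this is the usual Hausdorff distance.
\<close>

definition hausdorff_distance :: "nat \<Rightarrow> (nat \<Rightarrow> real) set \<Rightarrow> (nat \<Rightarrow> real) set \<Rightarrow> ennreal" where
  "hausdorff_distance j A B =
     max (SUP a\<in>A. INF b\<in>B. ennreal (vnorm j (\<lambda>i. a i - b i)))
         (SUP b\<in>B. INF a\<in>A. ennreal (vnorm j (\<lambda>i. a i - b i)))"

definition q_vec :: "(nat \<Rightarrow> 'z \<Rightarrow> real) \<Rightarrow> nat \<Rightarrow> 'z \<Rightarrow> nat \<Rightarrow> real" where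
  "q_vec q j z = (\<lambda>i. if i < j then q i z else 0)"

definition vec_integral :: "'z measure \<Rightarrow> ('z \<Rightarrow> nat \<Rightarrow> real) \<Rightarrow> nat \<Rightarrow> real" where
  "vec_integral \<gamma> h = (\<lambda>i. \<integral>z. h z i \<partial>\<gamma>)"

definition V_h ::
  "'y::topological_space set \<Rightarrow> 'u::metric_space set \<Rightarrow> 's::metric_space set \<Rightarrow>
   ('y \<times> 'u \<times> 's \<Rightarrow> 'y) \<Rightarrow> 'w measure \<Rightarrow> (nat \<Rightarrow> 'w \<Rightarrow> 's) \<Rightarrow>
   ('y \<times> 'u \<Rightarrow> nat \<Rightarrow> real) \<Rightarrow> nat \<Rightarrow> 'y \<Rightarrow> (nat \<Rightarrow> real) set" where
  "V_h Y U S f M \<sigma> h T y0 = (\<lambda>\<gamma>. vec_integral \<gamma> h) ` expected_occ_set Y U S f M \<sigma> T y0"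

text \<open>The sums run over \<open>t = 0, \<dots>, T\<close> (inclusive) while the normalization is \<open>1/T\<close>.\<close>

definition strong_h_approximation ::
  "'y set \<Rightarrow> 'u::metric_space set \<Rightarrow> 's::metric_space set \<Rightarrow> ('y \<times> 'u \<times> 's \<Rightarrow> 'y) \<Rightarrow>
   'w measure \<Rightarrow> (nat \<Rightarrow> 'w \<Rightarrow> 's) \<Rightarrow> nat \<Rightarrow> ('y \<times> 'u \<Rightarrow> nat \<Rightarrow> real) \<Rightarrow> bool" where
  "strong_h_approximation Y U S f M \<sigma> j h \<longleftrightarrow>
     (\<exists>\<nu> :: real \<Rightarrow> real.
        (\<forall>T\<ge>0. \<nu> T \<ge> 0) \<and> antimono_on {0..} \<nu> \<and> (\<nu> \<longlongrightarrow> 0) at_top \<and>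
        (\<forall>T::nat. T \<ge> 1 \<longrightarrow>
          (\<forall>y'\<in>Y. \<forall>y''\<in>Y. \<forall>\<pi>'\<in>control_plans U S. \<exists>\<pi>''\<in>control_plans U S.
             (\<integral>\<omega>. vnorm j (\<lambda>i.
                  1 / real T * (\<Sum>t\<le>T. h (trajectory f \<pi>' y' (\<lambda>n. \<sigma> n \<omega>) t) i)
                - 1 / real T * (\<Sum>t\<le>T. h (trajectory f \<pi>'' y'' (\<lambda>n. \<sigma> n \<omega>) t) i)) \<partial>M)
             \<le> \<nu> (real T))))"

definition Gamma_set ::
  "'z::topological_space set \<Rightarrow> (nat \<Rightarrow> 'z \<Rightarrow> real) \<Rightarrow> (nat \<Rightarrow> (nat \<Rightarrow> real) set) \<Rightarrow> 'z measure set" where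
  "Gamma_set K q V =
     {\<gamma> \<in> borel_prob_measures K. \<forall>j\<ge>1. vec_integral \<gamma> (q_vec q j) \<in> V j}"

end

theory Submission
  imports Defs
begin

text \<open>
  Fix finitely many of the functions \<open>q i\<close> and a long block length \<open>L\<close>. From every initial state
  some plan makes the expectations of the averages of these \<open>q i\<close> over one block almost equal to
  their integrals against \<open>\<gamma>\<close>. Since plans depend on the noise only, the same plan still works
  from all nearby states, so countably many plans and a Borel choice among them suffice.
  Restarting the chosen plan at the beginning of every block gives block sums whose
  conditional expectations given the past are nearly constant. A second moment estimate then
  shows that the averages over \<open>T\<close> steps are close to the integrals against \<open>\<gamma>\<close> in mean, with
  bounds independent of \<open>\<gamma>\<close> and of the initial state.
\<close>

section \<open>Measurability and compactness\<close>

text \<open>The hypothesis concerns expected occupational measures, while \<open>rho_E\<close> asks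
  the random ones to be close in mean; a plan with the right expectation may still produce widely
  spread averages. Restarting supplies the missing law of large numbers: whatever state a block
  starts from, the expectation of its total deviation from the target is at most
  \<open>L * \<eta>\<close> in absolute value, so the deviations of different blocks are almost
  orthogonal. The second moment over \<open>n\<close> blocks is then of order
  \<open>L\<^sup>2 * (n + \<eta> * n\<^sup>2)\<close>, and division by
  \<open>(n * L)\<^sup>2\<close> leaves \<open>1 / n + \<eta>\<close>.

  The restarted plan must again be a Borel function of the noise, which is why plans are chosen
  through a measurable index in the natural numbers. Uniformity comes from the order of choices:
  \<open>L\<close> and the threshold for \<open>T\<close> depend on \<open>\<epsilon>\<close> and
  the rate \<open>\<nu>'\<close>, whereas the plan may depend on \<open>\<gamma>\<close> and
  \<open>y0\<close>. Restricting to finitely many \<open>q i\<close> costs a tail of the geometric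
  weights in \<open>rho\<close>.\<close>

lemma compact_countable_dense:
  fixes A :: "'a::metric_space set"
  assumes "compact A"
  obtains C where "countable C" "C \<subseteq> A" "\<And>x e. x \<in> A \<Longrightarrow> e > 0 \<Longrightarrow> \<exists>c\<in>C. dist x c < e"
proof -
  have "\<forall>e>0. \<exists>k. finite k \<and> k \<subseteq> A \<and> A \<subseteq> (\<Union>x\<in>k. ball x e)"
    using assms by (simp add: seq_compact_imp_totally_bounded compact_eq_seq_compact_metric)
  then have "\<exists>k. finite k \<and> k \<subseteq> A \<and> A \<subseteq> (\<Union>x\<in>k. ball x (1 / Suc n))" for n :: nat
    by (meson of_nat_0_less_iff zero_less_Suc zero_less_divide_1_iff)
  then obtain k where k: "\<And>n. finite (k n)" "\<And>n. k n \<subseteq> A"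
    "\<And>n. A \<subseteq> (\<Union>x\<in>k n. ball x (1 / Suc n))"
    by metis
  show thesis
  proof
    show "countable (\<Union>n. k n)" using k(1) by (auto intro: countable_finite)
    show "(\<Union>n. k n) \<subseteq> A" using k(2) by auto
    fix x and e :: real assume x: "x \<in> A" and e: "e > 0"
    obtain n where n: "1 / Suc n < e" using e by (meson nat_approx_posE)
    obtain c where "c \<in> k n" "x \<in> ball c (1 / Suc n)" using k(3)[of n] x by blast
    then show "\<exists>c\<in>\<Union>n. k n. dist x c < e"
      using n by (intro bexI[of _ c]) (auto simp: dist_commute)
  qed
qed

text \<open>The types need not be second countable, so the Borel sets of the product type may
  exceed the product sigma-algebra; compactness of the two sets rules this out.\<close>

lemma measurable_Pair_restrict_borel:
  fixes A :: "'a::metric_space set" and B :: "'b::metric_space set"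
  assumes "compact A" "compact B"
    and g: "g \<in> N \<rightarrow>\<^sub>M restrict_space borel A" and h: "h \<in> N \<rightarrow>\<^sub>M restrict_space borel B"
  shows "(\<lambda>x. (g x, h x)) \<in> N \<rightarrow>\<^sub>M restrict_space borel (A \<times> B)"
proof (rule measurable_restrict_space2)
  have gA: "g x \<in> A" and hB: "h x \<in> B" if "x \<in> space N" for x
    using measurable_space[OF g that] measurable_space[OF h that]
    by (auto simp: space_restrict_space)
  then show "(\<lambda>x. (g x, h x)) \<in> space N \<rightarrow> A \<times> B" by auto
  have [measurable]: "g \<in> borel_measurable N" "h \<in> borel_measurable N"
    using g h by (auto simp: measurable_restrict_space2_iff)
  obtain C where C: "countable C" "\<And>x e. x \<in> A \<Longrightarrow> e > 0 \<Longrightarrow> \<exists>c\<in>C. dist x c < e"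
    using compact_countable_dense[OF \<open>compact A\<close>] by metis
  obtain D where D: "countable D" "\<And>x e. x \<in> B \<Longrightarrow> e > 0 \<Longrightarrow> \<exists>c\<in>D. dist x c < e"
    using compact_countable_dense[OF \<open>compact B\<close>] by metis
  show "(\<lambda>x. (g x, h x)) \<in> borel_measurable N"
  proof (rule borel_measurableI)
    fix W :: "('a \<times> 'b) set" assume W: "open W"
    \<comment> \<open>The part of \<open>W\<close> inside \<open>A \<times> B\<close> is covered by
      countably many product balls contained in \<open>W\<close>, with centres in the dense sets;
      the preimage of such a rectangle splits into one condition on \<open>g\<close> and one on
      \<open>h\<close>.\<close>
    define J where "J = {(c, d, n::nat). c \<in> C \<and> d \<in> D \<and>
      ball c (1 / Suc n) \<times> ball d (1 / Suc n) \<subseteq> W}"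
    have "J \<subseteq> C \<times> D \<times> UNIV" by (auto simp: J_def)
    then have J: "countable J"
      using C(1) D(1) by (meson countableI_type countable_SIGMA countable_subset)
    have "(\<lambda>x. (g x, h x)) -` W \<inter> space N =
      (\<Union>(c, d, n)\<in>J. (g -` ball c (1 / Suc n) \<inter> space N) \<inter> (h -` ball d (1 / Suc n) \<inter> space N))"
      (is "?L = ?R")
    proof
      show "?R \<subseteq> ?L" unfolding J_def by blast
      show "?L \<subseteq> ?R"
      proof
        fix x assume x: "x \<in> ?L"
        then have xW: "(g x, h x) \<in> W" and xN: "x \<in> space N" by auto
        obtain P Q where PQ: "open P" "open Q" "g x \<in> P" "h x \<in> Q" "P \<times> Q \<subseteq> W"
          using open_prod_elim[OF W xW] by (metis mem_Sigma_iff)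
        obtain e1 where e1: "e1 > 0" "ball (g x) e1 \<subseteq> P" using PQ by (meson open_contains_ball)
        obtain e2 where e2: "e2 > 0" "ball (h x) e2 \<subseteq> Q" using PQ by (meson open_contains_ball)
        \<comment> \<open>Half the radii, since the ball about a nearby centre \<open>c\<close> has
          to contain \<open>g x\<close> and still lie in \<open>ball (g x) e1\<close>; likewise for
          \<open>h x\<close>.\<close>
        obtain n where n: "1 / Suc n < min e1 e2 / 2"
          using nat_approx_posE[of "min e1 e2 / 2"] e1 e2 by auto
        obtain c where c: "c \<in> C" "dist (g x) c < 1 / Suc n"
          using C(2)[OF gA[OF xN], of "1 / Suc n"] by auto
        obtain d where d: "d \<in> D" "dist (h x) d < 1 / Suc n"
          using D(2)[OF hB[OF xN], of "1 / Suc n"] by auto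
        have "ball c (1 / Suc n) \<subseteq> P"
        proof
          fix z assume z: "z \<in> ball c (1 / Suc n)"
          have "dist (g x) z \<le> dist (g x) c + dist c z" by (rule dist_triangle)
          also have "\<dots> < e1" using z c n by (auto simp: min_def split: if_splits)
          finally show "z \<in> P" using e1 by auto
        qed
        moreover have "ball d (1 / Suc n) \<subseteq> Q"
        proof
          fix z assume z: "z \<in> ball d (1 / Suc n)"
          have "dist (h x) z \<le> dist (h x) d + dist d z" by (rule dist_triangle)
          also have "\<dots> < e2" using z d n by (auto simp: min_def split: if_splits)
          finally show "z \<in> Q" using e2 by auto
        qed
        ultimately have "ball c (1 / Suc n) \<times> ball d (1 / Suc n) \<subseteq> W" using PQ(5) by blast
        then have "(c, d, n) \<in> J" using c d by (simp add: J_def)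
        then show "x \<in> ?R" using c d xN by (intro UN_I[of "(c, d, n)"]) (auto simp: dist_commute)
      qed
    qed
    also have "\<dots> \<in> sets N"
      using J by (intro sets.countable_UN') auto
    finally show "(\<lambda>x. (g x, h x)) -` W \<inter> space N \<in> sets N" .
  qed
qed

text \<open>In the application \<open>x\<close> bundles two states, a plan and a noise path,
  \<open>m\<close> is the distance of the two states, and \<open>i\<close> is a pair of a test
  function index and a time inside the block.\<close>

lemma finite_common_delta:
  assumes "finite I"
    and "\<And>i. i \<in> I \<Longrightarrow> \<exists>\<delta>>0::real. \<forall>x. m x < \<delta> \<longrightarrow> R i x"
  shows "\<exists>\<delta>>0::real. \<forall>i\<in>I. \<forall>x. m x < \<delta> \<longrightarrow> R i x"
  using assms
proof (induction I)
  case empty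
  then show ?case by (auto intro: exI[of _ 1])
next
  case (insert a I)
  obtain d where "d > 0" "\<forall>i\<in>I. \<forall>x. m x < d \<longrightarrow> R i x" using insert by auto
  moreover obtain e where "e > 0" "\<forall>x. m x < e \<longrightarrow> R a x"
    using insert.prems[of a] by blast
  ultimately show ?case by (intro exI[of _ "min d e"]) auto
qed

section \<open>Trajectories\<close>

lemma state_cong:
  "(\<And>i. i < t \<Longrightarrow> s i = s' i) \<Longrightarrow> state f \<pi> y s t = state f \<pi> y s' t"
proof (induction t)
  case (Suc t)
  have "restrict s {..<t} = restrict s' {..<t}" using Suc by auto
  then show ?case using Suc by (simp add: control_def)
qed simp

locale controlled_system =
  fixes Y :: "'y::metric_space set" and U :: "'u::metric_space set" and S :: "'s::metric_space set"
    and f :: "'y \<times> 'u \<times> 's \<Rightarrow> 'y"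
  assumes compact_Y: "compact Y" and compact_U: "compact U" and compact_S: "compact S"
    and cont_f: "continuous_on (Y \<times> U \<times> S) f"
    and f_in: "\<And>y u s. y \<in> Y \<Longrightarrow> u \<in> U \<Longrightarrow> s \<in> S \<Longrightarrow> f (y, u, s) \<in> Y"
begin

abbreviation "BS \<equiv> restrict_space borel S"
abbreviation "BU \<equiv> restrict_space borel U"
abbreviation "BY \<equiv> restrict_space borel Y"
abbreviation "BK \<equiv> restrict_space borel (Y \<times> U)"

lemma control_measurable:
  assumes "\<pi> \<in> control_plans U S" and "\<And>i. i < t \<Longrightarrow> (\<lambda>\<omega>. X \<omega> i) \<in> N \<rightarrow>\<^sub>M BS"
  shows "(\<lambda>\<omega>. control \<pi> (X \<omega>) t) \<in> N \<rightarrow>\<^sub>M BU"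
proof -
  have "(\<lambda>\<omega>. restrict (X \<omega>) {..<t}) \<in> N \<rightarrow>\<^sub>M (\<Pi>\<^sub>M i\<in>{..<t}. BS)"
    using assms(2) by (intro measurable_restrict) auto
  moreover have "\<pi> t \<in> (\<Pi>\<^sub>M i\<in>{..<t}. BS) \<rightarrow>\<^sub>M BU"
    using assms(1) by (auto simp: control_plans_def)
  ultimately show ?thesis
    unfolding control_def by (rule measurable_compose)
qed

lemma f_measurable: "f \<in> restrict_space borel (Y \<times> U \<times> S) \<rightarrow>\<^sub>M BY"
  using f_in by (intro measurable_restrict_space2 borel_measurable_continuous_on_restrict cont_f)
    (auto simp: space_restrict_space)

text \<open>The initial state is itself random here, because a block of the concatenated plan starts
  from a state determined by earlier noise. Measurability is asked of the coordinates below
  \<open>t\<close> alone, so that the lemma applies on the finite products on which plans are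
  defined.\<close>

lemma state_measurable:
  assumes "\<pi> \<in> control_plans U S" and "y \<in> N \<rightarrow>\<^sub>M BY"
    and "\<And>i. i < t \<Longrightarrow> (\<lambda>\<omega>. X \<omega> i) \<in> N \<rightarrow>\<^sub>M BS"
  shows "(\<lambda>\<omega>. state f \<pi> (y \<omega>) (X \<omega>) t) \<in> N \<rightarrow>\<^sub>M BY"
  using assms(3)
proof (induction t)
  case 0
  then show ?case using assms(2) by simp
next
  case (Suc t)
  have "(\<lambda>\<omega>. (control \<pi> (X \<omega>) t, X \<omega> t)) \<in> N \<rightarrow>\<^sub>M restrict_space borel (U \<times> S)"
    using Suc.prems by (intro measurable_Pair_restrict_borel compact_U compact_S
        control_measurable assms(1)) auto
  then have "(\<lambda>\<omega>. (state f \<pi> (y \<omega>) (X \<omega>) t, control \<pi> (X \<omega>) t, X \<omega> t))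
      \<in> N \<rightarrow>\<^sub>M restrict_space borel (Y \<times> U \<times> S)"
    using Suc.IH Suc.prems
    by (intro measurable_Pair_restrict_borel[OF compact_Y compact_Times[OF compact_U compact_S]]) auto
  then show ?case
    using measurable_compose[OF _ f_measurable] by simp
qed

lemma trajectory_measurable:
  assumes "\<pi> \<in> control_plans U S" and "y \<in> Y"
    and "\<And>i. i < t \<Longrightarrow> (\<lambda>\<omega>. X \<omega> i) \<in> N \<rightarrow>\<^sub>M BS"
  shows "(\<lambda>\<omega>. trajectory f \<pi> y (X \<omega>) t) \<in> N \<rightarrow>\<^sub>M BK"
  unfolding trajectory_def
  using assms by (intro measurable_Pair_restrict_borel compact_Y compact_U state_measurable
      control_measurable) (auto simp: space_restrict_space)

text \<open>Values in \<open>U\<close> are part of measurability into \<open>BU\<close>: the fixed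
  path \<open>s\<close> is read as a random path on a one-point space.\<close>

lemma control_in:
  assumes "\<pi> \<in> control_plans U S" and "\<And>i. i < t \<Longrightarrow> s i \<in> S"
  shows "control \<pi> s t \<in> U"
  using measurable_space[OF control_measurable[OF assms(1), where N="count_space {()}" and X="\<lambda>_. s" and t=t]]
    assms(2) by (auto simp: space_restrict_space)

lemma state_in:
  assumes "\<pi> \<in> control_plans U S" "y \<in> Y" and "\<And>i. i < t \<Longrightarrow> s i \<in> S"
  shows "state f \<pi> y s t \<in> Y"
  using assms(3) by (induction t) (auto intro!: f_in control_in assms(1,2))

lemma trajectory_in:
  assumes "\<pi> \<in> control_plans U S" "y \<in> Y" and "\<And>i. i < t \<Longrightarrow> s i \<in> S"
  shows "trajectory f \<pi> y s t \<in> Y \<times> U"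
  using assms state_in control_in by (auto simp: trajectory_def)

lemma const_control_plan:
  assumes "u \<in> U"
  shows "(\<lambda>_ _. u) \<in> control_plans U S"
  using assms by (auto simp: control_plans_def space_restrict_space)

text \<open>Plans are functions of the noise alone, so one and the same plan can be applied from
  nearby initial states, and then only the state component of the trajectory changes.\<close>

lemma state_uniformly_continuous:
  assumes "e > 0"
  shows "\<exists>\<delta>>0. \<forall>y\<in>Y. \<forall>y'\<in>Y. \<forall>\<pi>\<in>control_plans U S. \<forall>s. (\<forall>i. s i \<in> S) \<longrightarrow> dist y y' < \<delta> \<longrightarrow>
    dist (state f \<pi> y s t) (state f \<pi> y' s t) < e"
  using assms
proof (induction t arbitrary: e)
  case 0
  then show ?case by auto
next
  case (Suc t)
  have "uniformly_continuous_on (Y \<times> U \<times> S) f"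
    by (intro compact_uniformly_continuous cont_f compact_Times compact_Y compact_U compact_S)
  then obtain d where d: "d > 0"
    "\<And>x x'. x \<in> Y \<times> U \<times> S \<Longrightarrow> x' \<in> Y \<times> U \<times> S \<Longrightarrow> dist x' x < d \<Longrightarrow> dist (f x') (f x) < e"
    using Suc.prems unfolding uniformly_continuous_on_def by metis
  obtain \<delta> where \<delta>: "\<delta> > 0" "\<forall>y\<in>Y. \<forall>y'\<in>Y. \<forall>\<pi>\<in>control_plans U S. \<forall>s. (\<forall>i. s i \<in> S) \<longrightarrow>
    dist y y' < \<delta> \<longrightarrow> dist (state f \<pi> y s t) (state f \<pi> y' s t) < d"
    using Suc.IH[OF d(1)] by blast
  show ?case
  proof (intro exI[of _ \<delta>] conjI ballI allI impI \<delta>(1))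
    fix y y' \<pi> and s :: "nat \<Rightarrow> 's"
    assume *: "y \<in> Y" "y' \<in> Y" "\<pi> \<in> control_plans U S" "\<forall>i. s i \<in> S" "dist y y' < \<delta>"
    show "dist (state f \<pi> y s (Suc t)) (state f \<pi> y' s (Suc t)) < e"
      unfolding state.simps using * \<delta>(2)
      by (intro d(2)) (auto simp: state_in control_in dist_Pair_Pair)
  qed
qed

lemma trajectory_uniformly_continuous:
  fixes h :: "'y \<times> 'u \<Rightarrow> real"
  assumes h: "uniformly_continuous_on (Y \<times> U) h" and "e > 0"
  shows "\<exists>\<delta>>0. \<forall>y\<in>Y. \<forall>y'\<in>Y. \<forall>\<pi>\<in>control_plans U S. \<forall>s. (\<forall>i. s i \<in> S) \<longrightarrow> dist y y' < \<delta> \<longrightarrow>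
    \<bar>h (trajectory f \<pi> y s t) - h (trajectory f \<pi> y' s t)\<bar> < e"
proof -
  obtain d where d: "d > 0"
    "\<And>x x'. x \<in> Y \<times> U \<Longrightarrow> x' \<in> Y \<times> U \<Longrightarrow> dist x' x < d \<Longrightarrow> dist (h x') (h x) < e"
    using h \<open>e > 0\<close> unfolding uniformly_continuous_on_def by metis
  obtain \<delta> where \<delta>: "\<delta> > 0" "\<forall>y\<in>Y. \<forall>y'\<in>Y. \<forall>\<pi>\<in>control_plans U S. \<forall>s. (\<forall>i. s i \<in> S) \<longrightarrow>
    dist y y' < \<delta> \<longrightarrow> dist (state f \<pi> y s t) (state f \<pi> y' s t) < d"
    using state_uniformly_continuous[OF d(1)] by blast
  show ?thesis
  proof (intro exI[of _ \<delta>] conjI ballI allI impI \<delta>(1))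
    fix y y' \<pi> and s :: "nat \<Rightarrow> 's"
    assume *: "y \<in> Y" "y' \<in> Y" "\<pi> \<in> control_plans U S" "\<forall>i. s i \<in> S" "dist y y' < \<delta>"
    have "dist (h (trajectory f \<pi> y s t)) (h (trajectory f \<pi> y' s t)) < e"
      using * \<delta>(2) by (intro d(2) trajectory_in) (auto simp: trajectory_def dist_Pair_Pair)
    then show "\<bar>h (trajectory f \<pi> y s t) - h (trajectory f \<pi> y' s t)\<bar> < e"
      by (simp add: dist_real_def)
  qed
qed

end

section \<open>Concatenation of plans\<close>

text \<open>A plan sees the noise only, while the restart rule \<open>sel\<close> looks at the
  current state. Recomputing the states at the times \<open>k * L\<close> from the noise avoids the
  circularity of defining a plan through its own trajectory; \<open>state_concat_plan\<close> shows
  afterwards that both agree.\<close>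

primrec block_state ::
  "('y \<times> 'u \<times> 's \<Rightarrow> 'y) \<Rightarrow> ('y \<Rightarrow> nat \<Rightarrow> (nat \<Rightarrow> 's) \<Rightarrow> 'u) \<Rightarrow> nat \<Rightarrow> 'y \<Rightarrow> (nat \<Rightarrow> 's) \<Rightarrow> nat \<Rightarrow> 'y"
where
  "block_state f sel L y0 s 0 = y0"
| "block_state f sel L y0 s (Suc k) =
     state f (sel (block_state f sel L y0 s k)) (block_state f sel L y0 s k) (\<lambda>i. s (k * L + i)) L"

definition concat_plan ::
  "('y \<times> 'u \<times> 's \<Rightarrow> 'y) \<Rightarrow> ('y \<Rightarrow> nat \<Rightarrow> (nat \<Rightarrow> 's) \<Rightarrow> 'u) \<Rightarrow> nat \<Rightarrow> 'y \<Rightarrow> nat \<Rightarrow> (nat \<Rightarrow> 's) \<Rightarrow> 'u"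
where
  "concat_plan f sel L y0 t s =
     control (sel (block_state f sel L y0 s (t div L))) (\<lambda>i. s (t div L * L + i)) (t mod L)"

lemma block_state_cong:
  "(\<And>i. i < k * L \<Longrightarrow> s i = s' i) \<Longrightarrow> block_state f sel L y0 s k = block_state f sel L y0 s' k"
proof (induction k)
  case (Suc k)
  have "block_state f sel L y0 s k = block_state f sel L y0 s' k" using Suc by auto
  then show ?case using Suc by (auto intro!: state_cong)
qed simp

text \<open>\<open>control\<close> truncates the path before time \<open>k * L + r\<close>. The
  truncation is invisible: the block state reads coordinates below \<open>k * L\<close>, and the
  plan inside the block reads the next \<open>r\<close> ones.\<close>

lemma control_concat_plan:
  assumes "r < L"
  shows "control (concat_plan f sel L y0) s (k * L + r) =
    control (sel (block_state f sel L y0 s k)) (\<lambda>i. s (k * L + i)) r"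
proof -
  let ?s = "restrict s {..<k * L + r}"
  have "(k * L + r) div L = k" "(k * L + r) mod L = r" using assms by auto
  moreover have "block_state f sel L y0 ?s k = block_state f sel L y0 s k"
    by (intro block_state_cong) auto
  moreover have "restrict (\<lambda>i. ?s (k * L + i)) {..<r} = restrict (\<lambda>i. s (k * L + i)) {..<r}"
    by auto
  ultimately show ?thesis by (simp add: control_def concat_plan_def)
qed

text \<open>The case \<open>r = L\<close> is included: the end of one block is the start of the
  next, which is the induction step of \<open>state_concat_plan\<close>.\<close>

lemma state_concat_plan_block:
  assumes "state f (concat_plan f sel L y0) y0 s (k * L) = block_state f sel L y0 s k" "r \<le> L"
  shows "state f (concat_plan f sel L y0) y0 s (k * L + r) =
    state f (sel (block_state f sel L y0 s k)) (block_state f sel L y0 s k) (\<lambda>i. s (k * L + i)) r"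
  using assms by (induction r) (auto simp: control_concat_plan)

lemma state_concat_plan:
  "state f (concat_plan f sel L y0) y0 s (k * L) = block_state f sel L y0 s k"
proof (induction k)
  case (Suc k)
  show ?case using state_concat_plan_block[OF Suc, of L] by (simp add: add.commute)
qed simp

lemma trajectory_concat_plan:
  assumes "r < L"
  shows "trajectory f (concat_plan f sel L y0) y0 s (k * L + r) =
    trajectory f (sel (block_state f sel L y0 s k)) (block_state f sel L y0 s k)
      (\<lambda>i. s (k * L + i)) r"
  using assms by (simp add: trajectory_def control_concat_plan state_concat_plan_block
      state_concat_plan)

context controlled_system
begin

lemma block_state_in:
  assumes "\<And>y. sel y \<in> control_plans U S" and "y0 \<in> Y" and "\<And>i. s i \<in> S"
  shows "block_state f sel L y0 s k \<in> Y"
  by (induction k) (auto intro!: state_in assms)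

text \<open>The selection is factored as \<open>P (I y)\<close> with a natural number
  \<open>I y\<close>: for each fixed index the next state is measurable, and countably many
  measurable pieces glue along a measurable index. No measurable structure on the set of plans is
  involved.\<close>

lemma block_state_measurable:
  assumes P: "\<And>i::nat. P i \<in> control_plans U S" and I: "I \<in> BY \<rightarrow>\<^sub>M count_space UNIV" and "y0 \<in> Y"
    and "\<And>i. i < k * L \<Longrightarrow> (\<lambda>\<omega>. X \<omega> i) \<in> N \<rightarrow>\<^sub>M BS"
  shows "(\<lambda>\<omega>. block_state f (\<lambda>y. P (I y)) L y0 (X \<omega>) k) \<in> N \<rightarrow>\<^sub>M BY"
  using assms(4)
proof (induction k)
  case 0
  then show ?case using \<open>y0 \<in> Y\<close> by (simp add: space_restrict_space)
next
  case (Suc k)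
  let ?b = "\<lambda>\<omega>. block_state f (\<lambda>y. P (I y)) L y0 (X \<omega>) k"
  have b: "?b \<in> N \<rightarrow>\<^sub>M BY" using Suc by auto
  have "(\<lambda>\<omega>. state f (P j) (?b \<omega>) (\<lambda>i. X \<omega> (k * L + i)) L) \<in> N \<rightarrow>\<^sub>M BY" for j
    using Suc.prems by (intro state_measurable P b) (auto simp: add.commute)
  from measurable_compose_countable[OF this measurable_compose[OF b I]]
 show ?case by simp
qed

lemma concat_plan_in:
  assumes P: "\<And>i::nat. P i \<in> control_plans U S" and I: "I \<in> BY \<rightarrow>\<^sub>M count_space UNIV" and "y0 \<in> Y"
    and "L > 0"
  shows "concat_plan f (\<lambda>y. P (I y)) L y0 \<in> control_plans U S"
  unfolding control_plans_def
proof (intro CollectI allI)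
  fix t :: nat
  let ?N = "\<Pi>\<^sub>M i\<in>{..<t}. BS"
  have t: "t div L * L + t mod L = t" by simp
  have comp: "(\<lambda>\<omega>. \<omega> i) \<in> ?N \<rightarrow>\<^sub>M BS" if "i < t" for i
    using that by (intro measurable_component_singleton) auto
  have "i < t" if "i < t div L * L" for i using that t by linarith
  then have b: "(\<lambda>\<omega>. block_state f (\<lambda>y. P (I y)) L y0 \<omega> (t div L)) \<in> ?N \<rightarrow>\<^sub>M BY"
    by (intro block_state_measurable P I \<open>y0 \<in> Y\<close> comp) auto
  have "t div L * L + i < t" if "i < t mod L" for i using that t by linarith
  then have "(\<lambda>\<omega>. control (P j) (\<lambda>i. \<omega> (t div L * L + i)) (t mod L)) \<in> ?N \<rightarrow>\<^sub>M BU" for j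
    by (intro control_measurable P comp) auto
  from measurable_compose_countable[OF this measurable_compose[OF b I]]
  show "concat_plan f (\<lambda>y. P (I y)) L y0 t \<in> ?N \<rightarrow>\<^sub>M BU"
    by (simp add: concat_plan_def[abs_def])
qed

end

section \<open>Second moments over the blocks\<close>

lemma trajectory_cong:
  "(\<And>i. i < Suc t \<Longrightarrow> s i = s' i) \<Longrightarrow> trajectory f \<pi> y s t = trajectory f \<pi> y s' t"
  by (auto simp: trajectory_def control_def intro!: state_cong arg_cong[of _ _ "\<pi> t"])

lemma sum_lessThan_add:
  fixes f :: "nat \<Rightarrow> 'a::comm_monoid_add"
  shows "(\<Sum>t<m + n. f t) = (\<Sum>t<m. f t) + (\<Sum>r<n. f (m + r))"
  by (induction n) (auto simp: add.assoc)

text \<open>\<open>D\<close> is the law of a single noise variable. On the space of noise paths,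
  past and future separate by Fubini, which replaces conditional expectations;
  \<open>integral_noise\<close> carries the results back to the given probability space.\<close>

locale noisy_system = controlled_system Y U S f + D: prob_space D
  for Y :: "'y::metric_space set" and U :: "'u::metric_space set" and S :: "'s::metric_space set"
    and f :: "'y \<times> 'u \<times> 's \<Rightarrow> 'y" and D :: "'s measure" +
  assumes sets_D: "sets D = sets (restrict_space borel S)"
begin

sublocale noise: sequence_space D
  by unfold_locales

lemma sets_noise: "sets noise.S = sets (\<Pi>\<^sub>M i\<in>UNIV. BS)"
  by (intro sets_PiM_cong refl sets_D)

lemma space_D: "space D = S"
  using sets_eq_imp_space_eq[OF sets_D] by (simp add: space_restrict_space)

lemma noise_in: "s \<in> space noise.S \<Longrightarrow> s i \<in> S"
  by (auto simp: space_PiM space_D)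

lemma noise_component [measurable]: "(\<lambda>s. s i) \<in> noise.S \<rightarrow>\<^sub>M BS"
  using measurable_component_singleton[of i UNIV "\<lambda>_. D"]
  by (simp add: measurable_cong_sets[OF refl sets_D])

lemma integrable_bounded:
  assumes "F \<in> borel_measurable noise.S" and "\<And>s. s \<in> space noise.S \<Longrightarrow> \<bar>F s\<bar> \<le> (C::real)"
  shows "integrable noise.S F"
  using assms by (intro noise.P.integrable_const_bound[where B=C]) auto

text \<open>The bound \<open>mean\<close> is uniform over starting states, so it can be applied with
  the random state at which a block begins.\<close>

context
  fixes P :: "nat \<Rightarrow> nat \<Rightarrow> (nat \<Rightarrow> 's) \<Rightarrow> 'u" and I :: "'y \<Rightarrow> nat" and L :: nat
    and g :: "'y \<times> 'u \<Rightarrow> real" and v \<eta> :: real and y0 :: 'y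
  assumes P: "\<And>i::nat. P i \<in> control_plans U S"
    and I: "I \<in> BY \<rightarrow>\<^sub>M count_space UNIV" and y0: "y0 \<in> Y" and L: "L > 0"
    and g: "g \<in> borel_measurable BK" "\<And>z. z \<in> Y \<times> U \<Longrightarrow> \<bar>g z\<bar> \<le> 1" and v: "\<bar>v\<bar> \<le> 1"
    and mean: "\<And>y. y \<in> Y \<Longrightarrow>
      \<bar>\<integral>s. (\<Sum>r<L. g (trajectory f (P (I y)) y s r) - v) \<partial>noise.S\<bar> \<le> L * \<eta>"
begin

abbreviation (input) "dev s t \<equiv> g (trajectory f (concat_plan f (\<lambda>y. P (I y)) L y0) y0 s t) - v"

lemma plan_in: "concat_plan f (\<lambda>y. P (I y)) L y0 \<in> control_plans U S"
  by (intro concat_plan_in P I y0 L)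

lemma dev_measurable: "(\<lambda>s. dev s t) \<in> borel_measurable noise.S"
  by (intro borel_measurable_diff measurable_const measurable_compose[OF trajectory_measurable g(1)]
      plan_in y0 noise_component) auto

lemma dev_bound: "s \<in> space noise.S \<Longrightarrow> \<bar>dev s t\<bar> \<le> 2"
  using g(2)[OF trajectory_in[OF plan_in y0, of t s]] v noise_in[of s] by fastforce

lemma sum_dev_bound:
  assumes "s \<in> space noise.S" "finite A"
  shows "\<bar>\<Sum>t\<in>A. dev s (k t)\<bar> \<le> 2 * card A"
  using sum_norm_bound[of A "\<lambda>t. dev s (k t)" 2] dev_bound[OF assms(1)] by (simp add: mult.commute)

text \<open>Conditionally on the noise before time \<open>n * L\<close>, the \<open>n\<close>-th block is a fresh run
  from the current block state.\<close>

lemma cross_moment: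
  "\<bar>\<integral>s. (\<Sum>t<n * L. dev s t) * (\<Sum>r<L. dev s (n * L + r)) \<partial>noise.S\<bar> \<le> 2 * L * n * (L * \<eta>)"
proof -
  interpret pair_prob_space noise.S noise.S ..
  define A where "A s = (\<Sum>t<n * L. dev s t)" for s
  define W where "W s = (\<Sum>r<L. dev s (n * L + r))" for s
  define b where "b s = block_state f (\<lambda>y. P (I y)) L y0 s n" for s
  define G where "G y s = (\<Sum>r<L. g (trajectory f (P (I y)) y s r) - v)" for y s
  have [measurable]: "A \<in> borel_measurable noise.S" "W \<in> borel_measurable noise.S"
    unfolding A_def W_def using dev_measurable by auto
  have A_le: "\<bar>A s\<bar> \<le> 2 * L * n" if "s \<in> space noise.S" for s
    using sum_dev_bound[OF that, of "{..<n * L}" "\<lambda>t. t"] by (simp add: A_def mult_ac)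
  have W_le: "\<bar>W s\<bar> \<le> 2 * L" if "s \<in> space noise.S" for s
    using sum_dev_bound[OF that, of "{..<L}" "\<lambda>r. n * L + r"] by (simp add: W_def)
  \<comment> \<open>The glued path follows \<open>s\<close> before time \<open>n * L\<close> and
    then runs through \<open>s'\<close> from its beginning. Hence \<open>A\<close> depends on
    \<open>s\<close> alone, and \<open>W\<close> depends on \<open>s\<close> only through the block
    state \<open>b s\<close>.\<close>
  let ?c = "comb_seq (n * L)"
  have A_comb: "A (?c s s') = A s" for s s'
    unfolding A_def
    by (intro sum.cong refl arg_cong2[where f=minus] arg_cong[where f=g] trajectory_cong)
      (auto simp: comb_seq_def)
  have W_comb: "W (?c s s') = G (b s) s'" for s s'
  proof -
    have "block_state f (\<lambda>y. P (I y)) L y0 (?c s s') n = b s"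
      unfolding b_def by (intro block_state_cong) (auto simp: comb_seq_def)
    then show ?thesis
      unfolding W_def G_def
      by (intro sum.cong refl) (auto simp: trajectory_concat_plan comb_seq_def)
  qed
  have b_in: "b s \<in> Y" if "s \<in> space noise.S" for s
    unfolding b_def using that by (intro block_state_in P y0) (auto simp: noise_in)
  have comb_space: "?c s s' \<in> space noise.S" if "s \<in> space noise.S" "s' \<in> space noise.S" for s s'
    using that by (auto simp: space_PiM comb_seq_def PiE_iff)
  have le: "\<bar>A s * W s\<bar> \<le> real (2 * L * n) * real (2 * L)" if "s \<in> space noise.S" for s
    unfolding abs_mult by (intro mult_mono A_le W_le that) auto
  have int: "integrable (noise.S \<Otimes>\<^sub>M noise.S) (\<lambda>(s, s'). A (?c s s') * W (?c s s'))"
    using le[OF comb_space]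
    by (intro P.integrable_const_bound[where B="real (2 * L * n) * real (2 * L)"])
      (auto simp: space_pair_measure)
  \<comment> \<open>Gluing two independent noise paths reproduces the law of the noise. With
    \<open>s\<close> fixed, the inner integral is that of a fresh block from \<open>b s\<close>, and
    \<open>mean\<close> bounds it.\<close>
  have "(\<integral>s. A s * W s \<partial>noise.S) =
      (\<integral>s. A s * W s \<partial>distr (noise.S \<Otimes>\<^sub>M noise.S) noise.S (\<lambda>(s, s'). ?c s s'))"
    by (simp add: noise.PiM_comb_seq)
  also have "\<dots> = (\<integral>(s, s'). A (?c s s') * W (?c s s') \<partial>(noise.S \<Otimes>\<^sub>M noise.S))"
    by (subst integral_distr) (auto intro: measurable_comb_seq simp: case_prod_beta')
  also have "\<dots> = (\<integral>s. (\<integral>s'. A (?c s s') * W (?c s s') \<partial>noise.S) \<partial>noise.S)"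
    using integral_fst'[OF int] by simp
  also have "\<dots> = (\<integral>s. A s * (\<integral>s'. G (b s) s' \<partial>noise.S) \<partial>noise.S)"
    by (simp add: A_comb W_comb)
  also have "\<bar>\<dots>\<bar> \<le> (\<integral>s. \<bar>A s * (\<integral>s'. G (b s) s' \<partial>noise.S)\<bar> \<partial>noise.S)"
    by (rule integral_abs_bound)
  also have "\<dots> \<le> (\<integral>s. 2 * L * n * (L * \<eta>) \<partial>noise.S)"
  proof (rule integral_mono')
    fix s assume s: "s \<in> space noise.S"
    have *: "\<bar>\<integral>s'. G (b s) s' \<partial>noise.S\<bar> \<le> L * \<eta>"
      unfolding G_def by (intro mean b_in s)
    then show "\<bar>A s * (\<integral>s'. G (b s) s' \<partial>noise.S)\<bar> \<le> 2 * L * n * (L * \<eta>)"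
      unfolding abs_mult by (intro mult_mono A_le s) auto
    then show "0 \<le> 2 * L * n * (L * \<eta>)" by (meson abs_ge_zero order_trans)
  qed auto
  also have "\<dots> = 2 * L * n * (L * \<eta>)"
    by (simp add: noise.P.prob_space)
  finally show ?thesis by (simp add: A_def W_def)
qed

text \<open>Expanding the square, block number \<open>n\<close> adds at most
  \<open>4 * L\<^sup>2\<close> from its own square and \<open>4 * L\<^sup>2 * \<eta> * n\<close>
  from twice the cross moment. The latter is absorbed by the growth of \<open>n\<^sup>2\<close> to
  \<open>(Suc n)\<^sup>2\<close>.\<close>

lemma second_moment:
  "(\<integral>s. (\<Sum>t<n * L. dev s t)\<^sup>2 \<partial>noise.S) \<le> 4 * L\<^sup>2 * n + 4 * L\<^sup>2 * \<eta> * n\<^sup>2"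
proof (induction n)
  case 0
  then show ?case by simp
next
  case (Suc n)
  have "0 \<le> L * \<eta>" using mean[OF y0] by linarith
  then have \<eta>: "\<eta> \<ge> 0" using L by (simp add: zero_le_mult_iff)
  define A where "A s = (\<Sum>t<n * L. dev s t)" for s
  define W where "W s = (\<Sum>r<L. dev s (n * L + r))" for s
  have [measurable]: "A \<in> borel_measurable noise.S" "W \<in> borel_measurable noise.S"
    unfolding A_def W_def using dev_measurable by auto
  have A_le: "\<bar>A s\<bar> \<le> 2 * L * n" if "s \<in> space noise.S" for s
    using sum_dev_bound[OF that, of "{..<n * L}" "\<lambda>t. t"] by (simp add: A_def mult_ac)
  have W_le: "\<bar>W s\<bar> \<le> 2 * L" if "s \<in> space noise.S" for s
    using sum_dev_bound[OF that, of "{..<L}" "\<lambda>r. n * L + r"] by (simp add: W_def)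
  have W2: "(W s)\<^sup>2 \<le> 4 * L\<^sup>2" if "s \<in> space noise.S" for s
    using power_mono[OF W_le[OF that], of 2] by (simp add: power_mult_distrib)
  have A2: "(A s)\<^sup>2 \<le> (2 * L * n)\<^sup>2" if "s \<in> space noise.S" for s
    using power_mono[OF A_le[OF that], of 2] by simp
  have intA: "integrable noise.S (\<lambda>s. (A s)\<^sup>2)"
    using A2 by (intro integrable_bounded[where C="(2 * L * n)\<^sup>2"]) auto
  have intW: "integrable noise.S (\<lambda>s. (W s)\<^sup>2)"
    using W2 by (intro integrable_bounded[where C="4 * L\<^sup>2"]) auto
  have AW: "\<bar>A s * W s\<bar> \<le> real (2 * L * n) * real (2 * L)" if "s \<in> space noise.S" for s
    unfolding abs_mult by (intro mult_mono A_le W_le that) auto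
  have intAW: "integrable noise.S (\<lambda>s. A s * W s)"
    using AW by (intro integrable_bounded) auto
  have split: "(\<Sum>t<Suc n * L. dev s t)\<^sup>2 = (A s)\<^sup>2 + (2 * (A s * W s) + (W s)\<^sup>2)" for s
    by (simp add: add.commute[of L] sum_lessThan_add A_def W_def power2_sum)
  have "(\<integral>s. (\<Sum>t<Suc n * L. dev s t)\<^sup>2 \<partial>noise.S) =
      (\<integral>s. (A s)\<^sup>2 \<partial>noise.S) + (2 * (\<integral>s. A s * W s \<partial>noise.S) + (\<integral>s. (W s)\<^sup>2 \<partial>noise.S))"
    unfolding split using intA intW intAW by simp
  also have "\<dots> \<le> (4 * L\<^sup>2 * n + 4 * L\<^sup>2 * \<eta> * n\<^sup>2) + (2 * (2 * L * n * (L * \<eta>)) + 4 * L\<^sup>2)"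
  proof (intro add_mono mult_left_mono)
    show "(\<integral>s. (A s)\<^sup>2 \<partial>noise.S) \<le> 4 * L\<^sup>2 * n + 4 * L\<^sup>2 * \<eta> * n\<^sup>2"
      using Suc.IH by (simp add: A_def)
    show "(\<integral>s. A s * W s \<partial>noise.S) \<le> 2 * L * n * (L * \<eta>)"
      using cross_moment[of n] by (simp add: A_def W_def)
    show "(\<integral>s. (W s)\<^sup>2 \<partial>noise.S) \<le> 4 * L\<^sup>2"
      using noise.P.integral_le_const[OF intW, of "4 * L\<^sup>2"] W2 by auto
  qed auto
  also have "\<dots> \<le> 4 * L\<^sup>2 * (Suc n) + 4 * L\<^sup>2 * \<eta> * (Suc n)\<^sup>2"
  proof -
    have "0 \<le> L\<^sup>2 * \<eta> * n" "0 \<le> L\<^sup>2 * \<eta>" using \<eta> by auto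
    then show ?thesis by (simp add: algebra_simps power2_eq_square)
  qed
  finally show ?case by simp
qed

text \<open>The first two terms come from the \<open>T div L\<close> complete blocks. The last pays
  for the incomplete one: fewer than \<open>L\<close> summands, each at most 2, divided by a total
  of at least \<open>(T div L) * L\<close>.\<close>

lemma mean_deviation_concat_plan:
  assumes "T \<ge> L" "\<kappa> > 0"
  shows "(\<integral>s. \<bar>(\<Sum>t<T. g (trajectory f (concat_plan f (\<lambda>y. P (I y)) L y0) y0 s t)) / T - v\<bar> \<partial>noise.S)
    \<le> \<kappa> + (4 / (T div L) + 4 * \<eta>) / \<kappa> + 2 / (T div L)"
proof -
  define n where "n = T div L"
  have n: "n > 0" using assms L by (simp add: n_def div_greater_zero_iff)
  have T: "T = n * L + T mod L" by (simp add: n_def)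
  have T0: "T > 0" using assms L by simp
  have nL: "n * L \<le> T" "0 < n * L" using T n L by auto
  then have nLr: "real n * real L \<le> real T" "0 < real n * real L"
    using n L by (auto simp flip: of_nat_mult)
  let ?A = "\<lambda>s. \<Sum>t<n * L. dev s t"
  have pt: "\<bar>(\<Sum>t<T. g (trajectory f (concat_plan f (\<lambda>y. P (I y)) L y0) y0 s t)) / T - v\<bar>
    \<le> (\<kappa> + 2 / n) + (?A s)\<^sup>2 / (\<kappa> * (n * L)\<^sup>2)" (is "?l \<le> _") if s: "s \<in> space noise.S" for s
  proof -
    have "?l = \<bar>\<Sum>t<T. dev s t\<bar> / T"
      using T0 by (simp add: sum_subtractf field_simps abs_divide[symmetric])
    also have "(\<Sum>t<T. dev s t) = ?A s + (\<Sum>r<T mod L. dev s (n * L + r))"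
      by (subst T) (rule sum_lessThan_add)
    also have "\<bar>\<dots>\<bar> / T \<le> (\<bar>?A s\<bar> + 2 * L) / T"
    proof (intro divide_right_mono order_trans[OF abs_triangle_ineq] add_left_mono)
      have "\<bar>\<Sum>r<T mod L. dev s (n * L + r)\<bar> \<le> 2 * (T mod L)"
        using sum_dev_bound[OF s, of "{..<T mod L}" "\<lambda>r. n * L + r"] by simp
      also have "\<dots> \<le> 2 * L" using L by (simp add: order_less_imp_le)
      finally show "\<bar>\<Sum>r<T mod L. dev s (n * L + r)\<bar> \<le> real (2 * L)" by simp
    qed simp
    also have "\<dots> \<le> (\<bar>?A s\<bar> + 2 * L) / (n * L)"
      using nLr by (intro divide_left_mono) auto
    also have "\<dots> = \<bar>?A s\<bar> / (n * L) + 2 / n"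
      using L by (simp add: add_divide_distrib)
    \<comment> \<open>This passes from the first moment to the second without square roots;
      \<open>\<kappa>\<close> stays free and is balanced against \<open>\<eta>\<close> in
      \<open>uniform_approximation\<close>.\<close>
    also have "x \<le> \<kappa> + x\<^sup>2 / \<kappa>" if "x \<ge> 0" for x
    proof (cases "x \<le> \<kappa>")
      case True
      then show ?thesis using assms by (simp add: add_increasing2)
    next
      case False
      then have "x * \<kappa> \<le> x * x" using that by (intro mult_left_mono) auto
      then have "x \<le> x\<^sup>2 / \<kappa>" using assms by (simp add: field_simps power2_eq_square)
      then show ?thesis using assms by simp
    qed
    from this[of "\<bar>?A s\<bar> / (n * L)"]
    have "\<bar>?A s\<bar> / (n * L) + 2 / n \<le> (\<kappa> + (\<bar>?A s\<bar> / (n * L))\<^sup>2 / \<kappa>) + 2 / n" by simp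
    also have "\<dots> = (\<kappa> + 2 / n) + (?A s)\<^sup>2 / (\<kappa> * (n * L)\<^sup>2)"
      by (simp add: power_divide mult.commute)
    finally show ?thesis .
  qed
  have "\<bar>?A s\<bar>\<^sup>2 \<le> (2 * (n * L))\<^sup>2" if "s \<in> space noise.S" for s
    using power_mono[OF sum_dev_bound[OF that, of "{..<n * L}" "\<lambda>t. t"], of 2] by simp
  then have int: "integrable noise.S (\<lambda>s. (?A s)\<^sup>2)"
    using dev_measurable
    by (intro integrable_bounded[where C="(2 * (n * L))\<^sup>2"] borel_measurable_power
        borel_measurable_sum) auto
  have "(\<integral>s. \<bar>(\<Sum>t<T. g (trajectory f (concat_plan f (\<lambda>y. P (I y)) L y0) y0 s t)) / T - v\<bar> \<partial>noise.S)
    \<le> (\<integral>s. (\<kappa> + 2 / n) + (?A s)\<^sup>2 / (\<kappa> * (n * L)\<^sup>2) \<partial>noise.S)"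
    using int assms by (intro integral_mono' pt) auto
  also have "\<dots> = (\<kappa> + 2 / n) + (\<integral>s. (?A s)\<^sup>2 \<partial>noise.S) / (\<kappa> * (n * L)\<^sup>2)"
    using int by (simp add: noise.P.prob_space)
  also have "\<dots> \<le> (\<kappa> + 2 / n) + (4 * L\<^sup>2 * n + 4 * L\<^sup>2 * \<eta> * n\<^sup>2) / (\<kappa> * (n * L)\<^sup>2)"
    using second_moment[of n] assms by (intro add_left_mono divide_right_mono) auto
  also have "\<dots> = \<kappa> + (4 / n + 4 * \<eta>) / \<kappa> + 2 / n"
    using n L assms by (simp add: field_simps power2_eq_square)
  finally show ?thesis by (simp add: n_def)
qed

end

end

section \<open>Occupational measures\<close>

lemma integral_empirical_measure:
  fixes g :: "'z::topological_space \<Rightarrow> real"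
  assumes "0 < T" and z: "\<And>t. t < T \<Longrightarrow> z t \<in> K" and g: "g \<in> borel_measurable (restrict_space borel K)"
  shows "(\<integral>x. g x \<partial>empirical_measure K T z) = (\<Sum>t<T. g (z t)) / T"
proof -
  have "z \<in> uniform_count_measure {..<T} \<rightarrow>\<^sub>M restrict_space borel K"
    using z by (auto simp: measurable_def sets_uniform_count_measure space_uniform_count_measure
        space_restrict_space)
  then show ?thesis
    using g by (simp add: empirical_measure_eq_distr[OF assms(1,2)] integral_distr
        integral_uniform_count_measure)
qed

locale stochastic_system = controlled_system Y U S f + prob_space M
  for Y :: "'y::metric_space set" and U :: "'u::metric_space set" and S :: "'s::metric_space set"
    and f :: "'y \<times> 'u \<times> 's \<Rightarrow> 'y" and M :: "'w measure" +
  fixes \<sigma> :: "nat \<Rightarrow> 'w \<Rightarrow> 's"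
  assumes indep: "indep_vars (\<lambda>_. restrict_space borel S) \<sigma> UNIV"
    and ident: "\<And>t. distr M (restrict_space borel S) (\<sigma> t) = distr M (restrict_space borel S) (\<sigma> 0)"
begin

lemma sigma_measurable: "\<sigma> t \<in> M \<rightarrow>\<^sub>M BS"
  using indep by (auto simp: indep_vars_def)

lemma sigma_in: "\<omega> \<in> space M \<Longrightarrow> \<sigma> t \<omega> \<in> S"
  using measurable_space[OF sigma_measurable] by (auto simp: space_restrict_space)

sublocale noisy_system Y U S f "distr M (restrict_space borel S) (\<sigma> 0)"
proof -
  interpret D: prob_space "distr M (restrict_space borel S) (\<sigma> 0)"
    by (rule prob_space_distr[OF sigma_measurable])
  show "noisy_system Y U S f (distr M (restrict_space borel S) (\<sigma> 0))"
    by unfold_locales simp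
qed

text \<open>Independence makes the joint law of all \<open>\<sigma> i\<close> the product of their
  laws, and identical distribution makes that product the path space built from the law of
  \<open>\<sigma> 0\<close>.\<close>

lemma integral_noise:
  fixes F :: "(nat \<Rightarrow> 's) \<Rightarrow> real"
  assumes F: "F \<in> borel_measurable noise.S"
  shows "(\<integral>\<omega>. F (\<lambda>i. \<sigma> i \<omega>) \<partial>M) = (\<integral>s. F s \<partial>noise.S)"
proof -
  have "distr M (\<Pi>\<^sub>M i\<in>UNIV. BS) (\<lambda>\<omega>. \<lambda>i\<in>UNIV. \<sigma> i \<omega>) = (\<Pi>\<^sub>M i\<in>UNIV. distr M BS (\<sigma> i))"
    using indep_vars_iff_distr_eq_PiM'[of UNIV \<sigma> "\<lambda>_. BS"] indep sigma_measurable by auto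
  also have "\<dots> = noise.S" using ident by (intro PiM_cong) auto
  finally have eq: "distr M (\<Pi>\<^sub>M i\<in>UNIV. BS) (\<lambda>\<omega> i. \<sigma> i \<omega>) = noise.S" by (simp add: restrict_def)
  have "(\<lambda>\<omega> i. \<sigma> i \<omega>) \<in> M \<rightarrow>\<^sub>M (\<Pi>\<^sub>M i\<in>UNIV. BS)"
    using sigma_measurable by (intro measurable_PiM_single') (auto simp: space_restrict_space sigma_in)
  moreover have "F \<in> borel_measurable (\<Pi>\<^sub>M i\<in>UNIV. BS)"
    using F by (simp add: measurable_cong_sets[OF sets_noise refl])
  ultimately show ?thesis by (simp add: integral_distr flip: eq)
qed

abbreviation "traj \<pi> y \<omega> t \<equiv> trajectory f \<pi> y (\<lambda>i. \<sigma> i \<omega>) t"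

context
  fixes \<pi> y
  assumes plan: "\<pi> \<in> control_plans U S" and y: "y \<in> Y"
begin

lemma traj_measurable: "(\<lambda>\<omega>. traj \<pi> y \<omega> t) \<in> M \<rightarrow>\<^sub>M BK"
  by (intro trajectory_measurable plan y sigma_measurable)

lemma traj_in: "\<omega> \<in> space M \<Longrightarrow> traj \<pi> y \<omega> t \<in> Y \<times> U"
  by (intro trajectory_in plan y sigma_in)

lemma integral_random_occ_measure:
  fixes g :: "'y \<times> 'u \<Rightarrow> real"
  assumes "0 < T" "g \<in> borel_measurable BK" "\<omega> \<in> space M"
  shows "(\<integral>z. g z \<partial>random_occ_measure Y U f \<sigma> \<pi> y T \<omega>) = (\<Sum>t<T. g (traj \<pi> y \<omega> t)) / T"
  unfolding random_occ_measure_def using assms traj_in by (intro integral_empirical_measure) auto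

text \<open>The expected occupational measure is the law of the trajectory at a uniformly
  distributed time in \<open>{..<T}\<close> independent of the noise. This is \<open>\<mu>\<close>,
  and Fubini computes integrals against it.\<close>

lemma integral_expected_occ_measure:
  fixes g :: "'y \<times> 'u \<Rightarrow> real"
  assumes T: "0 < T" and g: "g \<in> borel_measurable BK" "\<And>z. z \<in> Y \<times> U \<Longrightarrow> \<bar>g z\<bar> \<le> C"
  shows "(\<integral>z. g z \<partial>expected_occ_measure Y U f M \<sigma> \<pi> y T) = (\<integral>\<omega>. (\<Sum>t<T. g (traj \<pi> y \<omega> t)) / T \<partial>M)"
proof -
  let ?C = "uniform_count_measure {..<T}"
  interpret C: prob_space ?C
    using T by (intro prob_space_uniform_count_measure) auto
  interpret Q: pair_prob_space M ?C ..
  define \<phi> where "\<phi> = (\<lambda>(\<omega>, t). traj \<pi> y \<omega> t)"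
  define \<mu> where "\<mu> = distr (M \<Otimes>\<^sub>M ?C) BK \<phi>"
  have snd: "snd \<in> M \<Otimes>\<^sub>M ?C \<rightarrow>\<^sub>M count_space {..<T}"
    using measurable_snd[of M ?C]
    by (simp add: measurable_cong_sets[OF refl, of ?C "count_space {..<T}"]
        sets_uniform_count_measure)
  have \<phi>: "\<phi> \<in> M \<Otimes>\<^sub>M ?C \<rightarrow>\<^sub>M BK"
    unfolding \<phi>_def case_prod_beta'
    by (intro measurable_compose_countable'[OF measurable_compose[OF measurable_fst traj_measurable] snd])
      auto
  have \<phi>_in: "\<phi> x \<in> Y \<times> U" if "x \<in> space (M \<Otimes>\<^sub>M ?C)" for x
    using measurable_space[OF \<phi> that] by (simp add: space_restrict_space)
  have *: "(\<integral>z. h z \<partial>\<mu>) = (\<integral>\<omega>. (\<Sum>t<T. h (traj \<pi> y \<omega> t)) / T \<partial>M)"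
    if h: "h \<in> borel_measurable BK" "\<And>z. z \<in> Y \<times> U \<Longrightarrow> \<bar>h z\<bar> \<le> B" for h :: "'y \<times> 'u \<Rightarrow> real" and B
  proof -
    have "integrable (M \<Otimes>\<^sub>M ?C) (\<lambda>x. h (\<phi> x))"
      using measurable_compose[OF \<phi> h(1)] h(2) \<phi>_in
      by (intro Q.P.integrable_const_bound[where B=B]) auto
    from Q.integral_fst'[OF this] show ?thesis
      unfolding \<mu>_def integral_distr[OF \<phi> h(1)]
      by (simp add: \<phi>_def integral_uniform_count_measure)
  qed
  interpret \<mu>: prob_space \<mu>
    unfolding \<mu>_def by (rule Q.P.prob_space_distr[OF \<phi>])
  have \<mu>: "sets \<mu> = sets BK" "space \<mu> = Y \<times> U"
    by (auto simp: \<mu>_def space_restrict_space)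
  have "emeasure \<mu> A = ennreal (\<integral>\<omega>. measure (random_occ_measure Y U f \<sigma> \<pi> y T \<omega>) A \<partial>M)"
    if A: "A \<in> sets BK" for A
  proof -
    have ind: "(indicator A :: _ \<Rightarrow> real) \<in> borel_measurable BK" using A by simp
    have m: "measure N A = (\<integral>z. indicator A z \<partial>N)" if "sets N = sets BK" for N :: "('y \<times> 'u) measure"
      using A that sets.sets_into_space[of A N] by (simp add: Int_absorb2)
    have "(\<integral>\<omega>. measure (random_occ_measure Y U f \<sigma> \<pi> y T \<omega>) A \<partial>M) =
        (\<integral>\<omega>. (\<Sum>t<T. indicator A (traj \<pi> y \<omega> t)) / T \<partial>M)"
    proof (rule Bochner_Integration.integral_cong[OF refl])
      fix \<omega> assume \<omega>: "\<omega> \<in> space M"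
      have "sets (random_occ_measure Y U f \<sigma> \<pi> y T \<omega>) = sets BK"
        using prob_space_empirical_measure[OF T, of "traj \<pi> y \<omega>" "Y \<times> U"] traj_in[OF \<omega>]
        by (auto simp: random_occ_measure_def borel_prob_measures_def)
      from m[OF this] integral_random_occ_measure[OF T ind \<omega>]
      show "measure (random_occ_measure Y U f \<sigma> \<pi> y T \<omega>) A = (\<Sum>t<T. indicator A (traj \<pi> y \<omega> t)) / T"
        by simp
    qed
    also have "\<dots> = measure \<mu> A"
      using *[OF ind, of 1] m[OF \<mu>(1)] by simp
    finally show ?thesis by (simp add: \<mu>.emeasure_eq_measure)
  qed
  \<comment> \<open>\<open>measure_of\<close> yields the zero measure unless its set function is a
    measure; agreement with \<open>emeasure \<mu>\<close> on the Borel sets settles this.\<close>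
  then have "expected_occ_measure Y U f M \<sigma> \<pi> y T = measure_of (Y \<times> U) (sets BK) (emeasure \<mu>)"
    unfolding expected_occ_measure_def
    using sets.space_closed[of \<mu>] sets.sigma_sets_eq[of \<mu>]
    by (intro measure_of_eq) (simp_all add: \<mu>)
  also have "\<dots> = \<mu>" using measure_of_of_measure[of \<mu>] by (simp add: \<mu>)
  finally show ?thesis
    using *[OF g] by simp
qed

end

end

section \<open>Approximation in the metric on measures\<close>

lemma abs_integral_le_1:
  fixes h :: "'z::topological_space \<Rightarrow> real"
  assumes "\<gamma> \<in> borel_prob_measures K" and "\<And>z. z \<in> K \<Longrightarrow> \<bar>h z\<bar> \<le> 1"
  shows "\<bar>\<integral>z. h z \<partial>\<gamma>\<bar> \<le> 1"
proof -
  interpret prob_space \<gamma> using assms(1) by (simp add: borel_prob_measures_def)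
  have "sets \<gamma> = sets (restrict_space borel K)" using assms(1) by (simp add: borel_prob_measures_def)
  from sets_eq_imp_space_eq[OF this] have "space \<gamma> = K" by (simp add: space_restrict_space)
  have "\<bar>\<integral>z. h z \<partial>\<gamma>\<bar> \<le> (\<integral>z. \<bar>h z\<bar> \<partial>\<gamma>)" by (rule integral_abs_bound)
  also have "\<dots> \<le> (\<integral>z. 1 \<partial>\<gamma>)"
    using assms(2) \<open>space \<gamma> = K\<close> by (intro integral_mono') auto
  finally show ?thesis by (simp add: prob_space)
qed

text \<open>Two integrals in \<open>[-1, 1]\<close> differ by at most 2, and the weights from index
  \<open>j\<close> on sum to \<open>(1/2) ^ j\<close>.\<close>

lemma rho_le:
  assumes "\<And>i. \<bar>\<integral>z. q i z \<partial>\<gamma>\<bar> \<le> 1" "\<And>i. \<bar>\<integral>z. q i z \<partial>\<mu>\<bar> \<le> 1"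
  shows "rho q \<gamma> \<mu> \<le>
    (\<Sum>i<j. (1/2) ^ Suc i * \<bar>(\<integral>z. q i z \<partial>\<gamma>) - (\<integral>z. q i z \<partial>\<mu>)\<bar>) + 2 * (1/2) ^ j"
proof -
  let ?d = "\<lambda>i. \<bar>(\<integral>z. q i z \<partial>\<gamma>) - (\<integral>z. q i z \<partial>\<mu>)\<bar>"
  have d: "?d i \<le> 2" for i using assms[of i] by linarith
  have geo: "(\<lambda>i. (1/2::real) ^ Suc i) sums 1" by (rule power_half_series)
  have sm: "summable (\<lambda>i. (1/2) ^ Suc i * ?d i)"
  proof (rule summable_comparison_test')
    show "summable (\<lambda>i. (1/2::real) ^ Suc i * 2)"
      using geo by (intro summable_mult2) (auto simp: sums_iff)
    show "norm ((1/2) ^ Suc i * ?d i) \<le> (1/2) ^ Suc i * 2" for i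
      using d[of i] by (simp add: abs_mult)
  qed
  have tail: "(\<lambda>i. (1/2::real) ^ Suc i * (2 * (1/2) ^ j)) sums (1 * (2 * (1/2) ^ j))"
    by (rule sums_mult2[OF geo])
  have "(\<Sum>i. (1/2) ^ Suc (i + j) * ?d (i + j)) \<le> (\<Sum>i. (1/2::real) ^ Suc i * (2 * (1/2) ^ j))"
  proof (rule suminf_le)
    show "(1/2) ^ Suc (i + j) * ?d (i + j) \<le> (1/2::real) ^ Suc i * (2 * (1/2) ^ j)" for i
      using mult_left_mono[OF d[of "i + j"], of "(1/2) ^ Suc (i + j)"] by (simp add: power_add mult_ac)
    show "summable (\<lambda>i. (1/2) ^ Suc (i + j) * ?d (i + j))"
      using summable_ignore_initial_segment[OF sm, of j] .
    show "summable (\<lambda>i. (1/2::real) ^ Suc i * (2 * (1/2) ^ j))" using tail by (simp add: sums_iff)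
  qed
  also have "\<dots> = 2 * (1/2) ^ j" using tail by (simp add: sums_iff)
  finally show ?thesis
    unfolding rho_def using suminf_split_initial_segment[OF sm, of j] by simp
qed

lemma abs_le_vnorm: "i < j \<Longrightarrow> \<bar>x i\<bar> \<le> vnorm j x"
  using member_le_L2_set[of "{..<j}" i "\<lambda>i. \<bar>x i\<bar>"] by (simp add: vnorm_def L2_set_def)

context stochastic_system
begin

text \<open>A state \<open>y\<close> borrows the plan of a dense point \<open>c (I y)\<close> near
  it. Continuity costs one \<open>\<eta>\<close> per step and \<open>block\<close> another, so the
  moment estimate is applied with \<open>2 * \<eta>\<close>; hence
  \<open>8 * \<eta>\<close>.\<close>

lemma approximation_by_concat_plan:
  fixes q :: "nat \<Rightarrow> 'y \<times> 'u \<Rightarrow> real" and v :: "nat \<Rightarrow> real" and L j :: nat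
  assumes L: "L > 0" and \<eta>: "\<eta> > 0" and y0: "y0 \<in> Y"
    and q: "\<And>i. uniformly_continuous_on (Y \<times> U) (q i)" "\<And>i z. z \<in> Y \<times> U \<Longrightarrow> \<bar>q i z\<bar> \<le> 1"
    and v: "\<And>i. i < j \<Longrightarrow> \<bar>v i\<bar> \<le> 1"
    and block: "\<And>y. y \<in> Y \<Longrightarrow> \<exists>\<pi>\<in>control_plans U S. \<forall>i<j.
      \<bar>(\<integral>\<omega>. (\<Sum>t<L. q i (traj \<pi> y \<omega> t)) / L \<partial>M) - v i\<bar> \<le> \<eta>"
  shows "\<exists>\<pi>\<in>control_plans U S. \<forall>i<j. \<forall>T\<ge>L. \<forall>\<kappa>>0.
    (\<integral>\<omega>. \<bar>(\<Sum>t<T. q i (traj \<pi> y0 \<omega> t)) / T - v i\<bar> \<partial>M)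
      \<le> \<kappa> + (4 / real (T div L) + 8 * \<eta>) / \<kappa> + 2 / real (T div L)"
proof -
  have qm: "q i \<in> borel_measurable BK" for i
    using uniformly_continuous_imp_continuous[OF q(1)] by (rule borel_measurable_continuous_on_restrict)
  define R where "R ir x \<longleftrightarrow> (case x of (y, y', \<pi>, s) \<Rightarrow>
      y \<in> Y \<longrightarrow> y' \<in> Y \<longrightarrow> \<pi> \<in> control_plans U S \<longrightarrow> (\<forall>i. s i \<in> S) \<longrightarrow>
      \<bar>q (fst ir) (trajectory f \<pi> y s (snd ir)) - q (fst ir) (trajectory f \<pi> y' s (snd ir))\<bar> < \<eta>)"
    for ir x
  have "\<exists>\<delta>>0. \<forall>x. dist (fst x) (fst (snd x)) < \<delta> \<longrightarrow> R ir x" for ir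
    using trajectory_uniformly_continuous[OF q(1)[of "fst ir"] \<eta>, of "snd ir"]
    unfolding R_def by (elim exE) (rule exI, auto)
  then obtain \<delta> where \<delta>: "\<delta> > 0"
    and all_near: "\<forall>ir\<in>{..<j} \<times> {..<L}. \<forall>x. dist (fst x) (fst (snd x)) < \<delta> \<longrightarrow> R ir x"
    using finite_common_delta[of "{..<j} \<times> {..<L}" "\<lambda>x. dist (fst x) (fst (snd x))" R] by blast
  have near: "\<bar>q i (trajectory f \<pi> y s r) - q i (trajectory f \<pi> y' s r)\<bar> < \<eta>"
    if "i < j" "r < L" "y \<in> Y" "y' \<in> Y" "\<pi> \<in> control_plans U S" "\<And>i. s i \<in> S" "dist y y' < \<delta>"
    for i r y y' \<pi> s
    using that all_near[rule_format, of "(i, r)" "(y, y', \<pi>, s)"] by (simp add: R_def)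
  obtain C where C: "countable C" "C \<subseteq> Y" "\<And>x e. x \<in> Y \<Longrightarrow> e > 0 \<Longrightarrow> \<exists>c\<in>C. dist x c < e"
    using compact_countable_dense[OF compact_Y] by metis
  have C0: "C \<noteq> {}" using C(3)[OF y0, of 1] by auto
  define c where "c = from_nat_into C"
  have c_in: "c k \<in> Y" for k using from_nat_into[OF C0, of k] C(2) by (auto simp: c_def)
  have c_dense: "\<exists>k. dist y (c k) < \<delta>" if "y \<in> Y" for y
    using C(3)[OF that \<delta>] from_nat_into_surj[OF C(1)] unfolding c_def by metis
  have "\<exists>P. \<forall>k. P k \<in> control_plans U S \<and> (\<forall>i<j.
      \<bar>(\<integral>\<omega>. (\<Sum>t<L. q i (traj (P k) (c k) \<omega> t)) / L \<partial>M) - v i\<bar> \<le> \<eta>)"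
    using block[OF c_in] by (intro choice allI) blast
  then obtain P where P: "\<And>k. P k \<in> control_plans U S"
    and P_mean: "\<And>k i. i < j \<Longrightarrow>
      \<bar>(\<integral>\<omega>. (\<Sum>t<L. q i (traj (P k) (c k) \<omega> t)) / L \<partial>M) - v i\<bar> \<le> \<eta>"
    by blast
  \<comment> \<open>Taking the first dense point within distance \<open>\<delta>\<close> makes the
    choice Borel, because each comparison of a distance with \<open>\<delta>\<close> is.\<close>
  define I where "I y = (LEAST k. dist y (c k) < \<delta>)" for y
  have I: "I \<in> BY \<rightarrow>\<^sub>M count_space UNIV"
    unfolding I_def
  proof (rule measurable_Least)
    fix k
    have "(\<lambda>y. dist y (c k)) \<in> borel_measurable BY"
      by (intro borel_measurable_continuous_on_restrict continuous_intros)
    then show "Measurable.pred BY (\<lambda>y. dist y (c k) < \<delta>)" by measurable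
  qed
  have I_near: "dist y (c (I y)) < \<delta>" if "y \<in> Y" for y
    unfolding I_def using c_dense[OF that] by (rule LeastI_ex)
  have q_traj: "(\<lambda>s. q i (trajectory f \<pi> y s t)) \<in> borel_measurable noise.S"
    if "\<pi> \<in> control_plans U S" "y \<in> Y" for i \<pi> y t
    using that by (intro measurable_compose[OF trajectory_measurable qm] noise_component)
  have mean: "\<bar>\<integral>s. (\<Sum>r<L. q i (trajectory f (P (I y)) y s r) - v i) \<partial>noise.S\<bar> \<le> L * (2 * \<eta>)"
    if i: "i < j" and y: "y \<in> Y" for i y
  proof -
    define X where "X x s = (\<Sum>r<L. q i (trajectory f (P (I y)) x s r) - v i)" for x s
    have Xm: "X x \<in> borel_measurable noise.S" if "x \<in> Y" for x
      unfolding X_def using q_traj[OF P that] by auto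
    have X_int: "integrable noise.S (X x)" if x: "x \<in> Y" for x
    proof (rule integrable_bounded[OF Xm[OF x]])
      fix s assume s: "s \<in> space noise.S"
      have "norm (q i (trajectory f (P (I y)) x s r) - v i) \<le> 2" for r
      proof -
        have "\<bar>q i (trajectory f (P (I y)) x s r)\<bar> \<le> 1"
          by (intro q(2) trajectory_in P x noise_in[OF s])
        then show ?thesis using v[OF i] by simp
      qed
      from sum_norm_bound[OF this, of "\<lambda>r. r" "{..<L}"]
      show "\<bar>X x s\<bar> \<le> 2 * L" by (simp add: X_def mult.commute)
    qed
    have diff: "\<bar>X y s - X (c (I y)) s\<bar> \<le> L * \<eta>" if s: "s \<in> space noise.S" for s
    proof -
      have "norm (q i (trajectory f (P (I y)) y s r) - q i (trajectory f (P (I y)) (c (I y)) s r)) \<le> \<eta>"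
        if "r \<in> {..<L}" for r
        using near[of i r y "c (I y)" "P (I y)" s] i y c_in P noise_in[OF s] I_near[OF y] that
        by (simp add: order_less_imp_le)
      from sum_norm_bound[of "{..<L}", OF this] show ?thesis
        by (simp add: X_def flip: sum_subtractf)
    qed
    have "\<bar>(\<integral>s. X y s \<partial>noise.S) - (\<integral>s. X (c (I y)) s \<partial>noise.S)\<bar>
        = \<bar>\<integral>s. X y s - X (c (I y)) s \<partial>noise.S\<bar>"
      using X_int[OF y] X_int[OF c_in] by simp
    also have "\<dots> \<le> (\<integral>s. \<bar>X y s - X (c (I y)) s\<bar> \<partial>noise.S)" by (rule integral_abs_bound)
    also have "\<dots> \<le> (\<integral>s. L * \<eta> \<partial>noise.S)"
      using diff \<eta> by (intro integral_mono') auto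
    finally have 1: "\<bar>(\<integral>s. X y s \<partial>noise.S) - (\<integral>s. X (c (I y)) s \<partial>noise.S)\<bar> \<le> L * \<eta>"
      by (simp add: noise.P.prob_space)
    have m: "(\<lambda>s. (\<Sum>t<L. q i (trajectory f (P (I y)) (c (I y)) s t)) / L) \<in> borel_measurable noise.S"
      using q_traj[OF P c_in] by auto
    have "(\<integral>\<omega>. (\<Sum>t<L. q i (traj (P (I y)) (c (I y)) \<omega> t)) / L \<partial>M) =
        (\<integral>s. X (c (I y)) s / L + v i \<partial>noise.S)"
      unfolding integral_noise[OF m] using L
      by (intro Bochner_Integration.integral_cong) (auto simp: X_def sum_subtractf field_simps)
    also have "\<dots> = (\<integral>s. X (c (I y)) s \<partial>noise.S) / L + v i"
      using X_int[OF c_in] by (simp add: noise.P.prob_space)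
    finally have "\<bar>(\<integral>s. X (c (I y)) s \<partial>noise.S) / L\<bar> \<le> \<eta>"
      using P_mean[OF i, of "I y"] by simp
    then have "\<bar>\<integral>s. X (c (I y)) s \<partial>noise.S\<bar> \<le> L * \<eta>"
      using L by (simp add: abs_divide field_simps)
    then have "\<bar>\<integral>s. X y s \<partial>noise.S\<bar> \<le> L * \<eta> + L * \<eta>" using 1 by linarith
    then show ?thesis by (simp add: X_def mult_ac)
  qed
  let ?\<pi> = "concat_plan f (\<lambda>y. P (I y)) L y0"
  have plan: "?\<pi> \<in> control_plans U S" by (intro concat_plan_in P I y0 L)
  show ?thesis
  proof (intro bexI[OF _ plan] allI impI)
    fix i T and \<kappa> :: real assume *: "i < j" "T \<ge> L" "\<kappa> > 0"
    have "(\<integral>\<omega>. \<bar>(\<Sum>t<T. q i (traj ?\<pi> y0 \<omega> t)) / T - v i\<bar> \<partial>M) =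
        (\<integral>s. \<bar>(\<Sum>t<T. q i (trajectory f ?\<pi> y0 s t)) / T - v i\<bar> \<partial>noise.S)"
      using q_traj[OF plan y0] by (intro integral_noise) auto
    also have "\<dots> \<le> \<kappa> + (4 / real (T div L) + 4 * (2 * \<eta>)) / \<kappa> + 2 / real (T div L)"
      using * by (intro mean_deviation_concat_plan P I y0 L qm q(2) v mean) auto
    finally show "(\<integral>\<omega>. \<bar>(\<Sum>t<T. q i (traj ?\<pi> y0 \<omega> t)) / T - v i\<bar> \<partial>M)
      \<le> \<kappa> + (4 / real (T div L) + 8 * \<eta>) / \<kappa> + 2 / real (T div L)" by simp
  qed
qed

text \<open>Each point of \<open>V\<close> has infimal distance at most \<open>\<nu>\<close> to the
  vectors of expected averages. The infimum may fail to be attained; the strict inequality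
  \<open>\<nu> < \<eta>\<close> provides an actual plan.\<close>

lemma hausdorff_block_plan:
  fixes q :: "nat \<Rightarrow> 'y \<times> 'u \<Rightarrow> real"
  assumes d: "hausdorff_distance j (V_h Y U S f M \<sigma> (q_vec q j) L y) V \<le> ennreal \<nu>" "\<nu> < \<eta>" "\<eta> > 0"
    and v: "v \<in> V" and y: "y \<in> Y" and L: "L > 0"
    and q: "\<And>i. q i \<in> borel_measurable BK" "\<And>i z. z \<in> Y \<times> U \<Longrightarrow> \<bar>q i z\<bar> \<le> 1"
  shows "\<exists>\<pi>\<in>control_plans U S. \<forall>i<j. \<bar>(\<integral>\<omega>. (\<Sum>t<L. q i (traj \<pi> y \<omega> t)) / L \<partial>M) - v i\<bar> \<le> \<eta>"
proof -
  let ?A = "V_h Y U S f M \<sigma> (q_vec q j) L y"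
  have "(INF a\<in>?A. ennreal (vnorm j (\<lambda>i. a i - v i)))
      \<le> (SUP b\<in>V. INF a\<in>?A. ennreal (vnorm j (\<lambda>i. a i - b i)))"
    using v by (rule SUP_upper)
  also have "\<dots> \<le> ennreal \<nu>"
    using d(1) by (simp add: hausdorff_distance_def)
  also have "\<dots> < ennreal \<eta>" using d by (simp add: ennreal_lessI)
  finally obtain a where a: "a \<in> ?A" "ennreal (vnorm j (\<lambda>i. a i - v i)) < ennreal \<eta>"
    by (auto simp: INF_less_iff)
  then have le: "vnorm j (\<lambda>i. a i - v i) < \<eta>"
    using d(3) by (simp add: ennreal_less_iff vnorm_def L2_set_nonneg)
  obtain \<pi> where \<pi>: "\<pi> \<in> control_plans U S"
    and a_eq: "a = vec_integral (expected_occ_measure Y U f M \<sigma> \<pi> y L) (q_vec q j)"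
    using a(1) by (auto simp: V_h_def expected_occ_set_def)
  have "a i = (\<integral>\<omega>. (\<Sum>t<L. q i (traj \<pi> y \<omega> t)) / L \<partial>M)" if "i < j" for i
    using integral_expected_occ_measure[OF \<pi> y L q(1)[of i], of 1] q(2) that
    by (simp add: a_eq vec_integral_def q_vec_def)
  moreover have "\<bar>a i - v i\<bar> \<le> \<eta>" if "i < j" for i
    using abs_le_vnorm[OF that, of "\<lambda>i. a i - v i"] le by simp
  ultimately show ?thesis using \<pi> by (intro bexI[of _ \<pi>]) auto
qed

lemma rho_E_le:
  fixes q :: "nat \<Rightarrow> 'y \<times> 'u \<Rightarrow> real"
  assumes \<gamma>: "\<gamma> \<in> borel_prob_measures (Y \<times> U)" and \<pi>: "\<pi> \<in> control_plans U S"
    and y: "y \<in> Y" and T: "T > 0"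
    and q: "\<And>i. q i \<in> borel_measurable BK" "\<And>i z. z \<in> Y \<times> U \<Longrightarrow> \<bar>q i z\<bar> \<le> 1"
    and dev: "\<And>i. i < j \<Longrightarrow>
      (\<integral>\<omega>. \<bar>(\<Sum>t<T. q i (traj \<pi> y \<omega> t)) / T - (\<integral>z. q i z \<partial>\<gamma>)\<bar> \<partial>M) \<le> \<beta>"
    and "\<beta> \<ge> 0"
  shows "rho_E q M \<gamma> (random_occ_set Y U S f \<sigma> T y) \<le> ennreal (\<beta> + 2 * (1/2) ^ j)"
proof -
  let ?X = "random_occ_measure Y U f \<sigma> \<pi> y T"
  define d where "d i \<omega> = \<bar>(\<Sum>t<T. q i (traj \<pi> y \<omega> t)) / T - (\<integral>z. q i z \<partial>\<gamma>)\<bar>" for i \<omega>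
  have X_prob: "?X \<omega> \<in> borel_prob_measures (Y \<times> U)" if "\<omega> \<in> space M" for \<omega>
    unfolding random_occ_measure_def using T traj_in[OF \<pi> y that]
    by (intro prob_space_empirical_measure) auto
  have qX: "(\<integral>z. q i z \<partial>?X \<omega>) = (\<Sum>t<T. q i (traj \<pi> y \<omega> t)) / T" if "\<omega> \<in> space M" for i \<omega>
    by (intro integral_random_occ_measure \<pi> y T q that)
  have q1: "\<bar>\<integral>z. q i z \<partial>\<gamma>\<bar> \<le> 1" for i
    by (intro abs_integral_le_1[OF \<gamma>] q(2))
  have X1: "\<bar>\<integral>z. q i z \<partial>?X \<omega>\<bar> \<le> 1" if "\<omega> \<in> space M" for i \<omega>
    by (intro abs_integral_le_1[OF X_prob[OF that]] q(2))
  have dm: "d i \<in> borel_measurable M" for i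
    unfolding d_def using measurable_compose[OF traj_measurable[OF \<pi> y] q(1)] by auto
  have d_le: "d i \<omega> \<le> 2" if "\<omega> \<in> space M" for i \<omega>
    using q1[of i] X1[OF that, of i] unfolding d_def qX[OF that] by linarith
  have d_int: "integrable M (d i)" for i
    using dm d_le by (intro integrable_const_bound[where B=2]) (auto simp: d_def)
  have "(\<integral>\<omega>. rho q \<gamma> (?X \<omega>) \<partial>M) \<le> (\<integral>\<omega>. (\<Sum>i<j. (1/2) ^ Suc i * d i \<omega>) + 2 * (1/2) ^ j \<partial>M)"
  \<comment> \<open>This rule asks for integrability of the upper bound alone, so the series
    \<open>rho\<close> need not be shown measurable in \<open>\<omega>\<close>.\<close>
  proof (rule integral_mono')
    fix \<omega> assume \<omega>: "\<omega> \<in> space M"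
    show "rho q \<gamma> (?X \<omega>) \<le> (\<Sum>i<j. (1/2) ^ Suc i * d i \<omega>) + 2 * (1/2) ^ j"
      using rho_le[where q=q and j=j, OF q1 X1[OF \<omega>]]
      by (simp add: qX[OF \<omega>] d_def abs_minus_commute)
    show "0 \<le> (\<Sum>i<j. (1/2) ^ Suc i * d i \<omega>) + 2 * (1/2) ^ j"
      by (intro add_nonneg_nonneg sum_nonneg) (auto simp: d_def)
  qed (use d_int in auto)
  also have "\<dots> = (\<Sum>i<j. (1/2) ^ Suc i * (\<integral>\<omega>. d i \<omega> \<partial>M)) + 2 * (1/2) ^ j"
    using d_int by (simp add: prob_space)
  also have "\<dots> \<le> (\<Sum>i<j. (1/2) ^ Suc i * \<beta>) + 2 * (1/2) ^ j"
    using dev unfolding d_def by (intro add_right_mono sum_mono mult_left_mono) auto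
  also have "(\<Sum>i<j. (1/2::real) ^ Suc i * \<beta>) \<le> 1 * \<beta>"
    using sum_le_suminf[of "\<lambda>i. (1/2::real) ^ Suc i" "{..<j}"] power_half_series \<open>\<beta> \<ge> 0\<close>
    unfolding sum_distrib_right[symmetric] by (intro mult_right_mono) (auto simp: sums_iff)
  finally have "(\<integral>\<omega>. rho q \<gamma> (?X \<omega>) \<partial>M) \<le> \<beta> + 2 * (1/2) ^ j" by simp
  moreover have "rho_E q M \<gamma> (random_occ_set Y U S f \<sigma> T y) \<le> ennreal (\<integral>\<omega>. rho q \<gamma> (?X \<omega>) \<partial>M)"
    unfolding rho_E_def random_occ_set_def using \<pi> by (intro INF_lower) auto
  ultimately show ?thesis by (meson ennreal_leI order_trans)
qed

lemma uniform_approximation: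
  fixes q :: "nat \<Rightarrow> 'y \<times> 'u \<Rightarrow> real" and V :: "nat \<Rightarrow> (nat \<Rightarrow> real) set"
  assumes q: "\<And>i. uniformly_continuous_on (Y \<times> U) (q i)" "\<And>i z. z \<in> Y \<times> U \<Longrightarrow> \<bar>q i z\<bar> \<le> 1"
    and V: "\<And>j. j \<ge> 1 \<Longrightarrow> \<exists>\<nu>' :: nat \<Rightarrow> real. \<nu>' \<longlonglongrightarrow> 0 \<and>
      (\<forall>y0\<in>Y. \<forall>T\<ge>1. hausdorff_distance j (V_h Y U S f M \<sigma> (q_vec q j) T y0) (V j) \<le> ennreal (\<nu>' T))"
    and \<epsilon>: "\<epsilon> > 0"
  shows "\<exists>T0. \<forall>T\<ge>T0. \<forall>\<gamma>\<in>Gamma_set (Y \<times> U) q V. \<forall>y0\<in>Y.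
    rho_E q M \<gamma> (random_occ_set Y U S f \<sigma> T y0) \<le> ennreal \<epsilon>"
proof -
  have qm: "q i \<in> borel_measurable BK" for i
    using uniformly_continuous_imp_continuous[OF q(1)] by (rule borel_measurable_continuous_on_restrict)
  obtain j0 where j0: "(1/2) ^ j0 < \<epsilon> / 4" using real_arch_pow_inv[of "\<epsilon> / 4" "1/2"] \<epsilon> by auto
  define j where "j = Suc j0"
  have j: "2 * (1/2) ^ j \<le> \<epsilon> / 4" "j \<ge> 1" using j0 by (auto simp: j_def)
  \<comment> \<open>With \<open>\<eta> = \<kappa>\<^sup>2 / 8\<close> the term
    \<open>8 * \<eta> / \<kappa>\<close> equals \<open>\<kappa>\<close>, and \<open>n0\<close> below
    makes the terms in \<open>1 / n\<close> less than \<open>\<kappa>\<close>. The mean deviation is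
    thus at most \<open>3 * \<kappa>\<close>, and \<open>3 * \<epsilon> / 8\<close> plus the tail
    \<open>\<epsilon> / 4\<close> stays below \<open>\<epsilon>\<close>.\<close>
  define \<kappa> where "\<kappa> = \<epsilon> / 8"
  define \<eta> where "\<eta> = \<kappa>\<^sup>2 / 8"
  have \<kappa>: "\<kappa> > 0" and \<eta>: "\<eta> > 0" using \<epsilon> by (auto simp: \<kappa>_def \<eta>_def)
  obtain \<nu>' :: "nat \<Rightarrow> real" where \<nu>': "\<nu>' \<longlonglongrightarrow> 0"
    "\<And>y0 T. y0 \<in> Y \<Longrightarrow> T \<ge> 1 \<Longrightarrow>
      hausdorff_distance j (V_h Y U S f M \<sigma> (q_vec q j) T y0) (V j) \<le> ennreal (\<nu>' T)"
    using V[OF j(2)] by blast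
  have "\<forall>\<^sub>F T in sequentially. \<nu>' T < \<eta> \<and> T \<ge> 1"
    using order_tendstoD(2)[OF \<nu>'(1) \<eta>] eventually_ge_at_top by (rule eventually_conj)
  then obtain L where L: "\<nu>' L < \<eta>" "L \<ge> 1" by (auto simp: eventually_sequentially)
  have "(\<lambda>n. (4 / \<kappa> + 2) * inverse (real n)) \<longlonglongrightarrow> 0"
    by (intro tendsto_mult_right_zero lim_inverse_n)
  from order_tendstoD(2)[OF this, of \<kappa>] \<kappa>
  obtain n0 where "\<And>n. n \<ge> n0 \<Longrightarrow> (4 / \<kappa> + 2) * inverse (real n) < \<kappa>"
    by (auto simp: eventually_sequentially)
  then have n0: "4 / real n / \<kappa> + 2 / real n < \<kappa>" if "n \<ge> n0" for n
    using that by (simp add: divide_inverse algebra_simps)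
  show ?thesis
  \<comment> \<open>\<open>Suc n0\<close> in place of \<open>n0\<close> guarantees a complete block,
    that is \<open>T \<ge> L > 0\<close>, even if \<open>n0 = 0\<close>.\<close>
  proof (intro exI[of _ "Suc n0 * L"] allI impI ballI)
    fix T \<gamma> y0 assume T: "T \<ge> Suc n0 * L" and \<gamma>: "\<gamma> \<in> Gamma_set (Y \<times> U) q V" and y0: "y0 \<in> Y"
    have \<gamma>p: "\<gamma> \<in> borel_prob_measures (Y \<times> U)" using \<gamma> by (simp add: Gamma_set_def)
    let ?v = "vec_integral \<gamma> (q_vec q j)"
    have v: "?v \<in> V j" using \<gamma> j by (simp add: Gamma_set_def)
    have v_eq: "?v i = (\<integral>z. q i z \<partial>\<gamma>)" if "i < j" for i
      using that by (simp add: vec_integral_def q_vec_def)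
    have v1: "\<bar>?v i\<bar> \<le> 1" if "i < j" for i
      unfolding v_eq[OF that] by (intro abs_integral_le_1[OF \<gamma>p] q)
    have TL: "T \<ge> L" "T > 0" using T L by auto
    have n: "T div L \<ge> n0" using div_le_mono[OF T, of L] L by simp
    have "\<exists>\<pi>\<in>control_plans U S. \<forall>i<j. \<forall>T\<ge>L. \<forall>\<kappa>>0.
        (\<integral>\<omega>. \<bar>(\<Sum>t<T. q i (traj \<pi> y0 \<omega> t)) / T - ?v i\<bar> \<partial>M)
          \<le> \<kappa> + (4 / real (T div L) + 8 * \<eta>) / \<kappa> + 2 / real (T div L)"
    proof (rule approximation_by_concat_plan[where v="?v" and q=q, OF _ \<eta> y0 q v1])
      show "0 < L" using L by simp
      show "\<exists>\<pi>\<in>control_plans U S. \<forall>i<j. \<bar>(\<integral>\<omega>. (\<Sum>t<L. q i (traj \<pi> y \<omega> t)) / L \<partial>M) - ?v i\<bar> \<le> \<eta>"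
        if "y \<in> Y" for y
        using L by (intro hausdorff_block_plan[OF \<nu>'(2)[OF that L(2)] L(1) \<eta> v that _ qm q(2)]) auto
    qed
    then obtain \<pi> where \<pi>: "\<pi> \<in> control_plans U S"
      and dev: "\<And>i. i < j \<Longrightarrow> (\<integral>\<omega>. \<bar>(\<Sum>t<T. q i (traj \<pi> y0 \<omega> t)) / T - ?v i\<bar> \<partial>M)
          \<le> \<kappa> + (4 / real (T div L) + 8 * \<eta>) / \<kappa> + 2 / real (T div L)"
      using TL \<kappa> by blast
    have "\<kappa> + (4 / real (T div L) + 8 * \<eta>) / \<kappa> + 2 / real (T div L) \<le> 3 * \<kappa>"
      using n0[OF n] \<kappa> by (simp add: \<eta>_def add_divide_distrib power2_eq_square)
    then have "(\<integral>\<omega>. \<bar>(\<Sum>t<T. q i (traj \<pi> y0 \<omega> t)) / T - (\<integral>z. q i z \<partial>\<gamma>)\<bar> \<partial>M) \<le> 3 * \<kappa>"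
      if "i < j" for i
      using dev[OF that] unfolding v_eq[OF that] by linarith
    then have "rho_E q M \<gamma> (random_occ_set Y U S f \<sigma> T y0) \<le> ennreal (3 * \<kappa> + 2 * (1/2) ^ j)"
      using \<kappa> by (intro rho_E_le[OF \<gamma>p \<pi> y0 TL(2) qm q(2)]) auto
    also have "\<dots> \<le> ennreal \<epsilon>"
      using j \<epsilon> by (intro ennreal_leI) (simp add: \<kappa>_def)
    finally show "rho_E q M \<gamma> (random_occ_set Y U S f \<sigma> T y0) \<le> ennreal \<epsilon>" .
  qed
qed

text \<open>A finite bound for every positive \<open>T\<close>. A probability measure on
  \<open>Y \<times> U\<close> forces \<open>U\<close> to be nonempty, so a constant plan exists and
  the infimum in \<open>rho_E\<close> is not the infimum of the empty set, which would be
  infinite.\<close>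

lemma rho_E_le_2:
  fixes q :: "nat \<Rightarrow> 'y \<times> 'u \<Rightarrow> real"
  assumes \<gamma>: "\<gamma> \<in> borel_prob_measures (Y \<times> U)" and y: "y \<in> Y" and T: "T > 0"
    and q: "\<And>i. q i \<in> borel_measurable BK" "\<And>i z. z \<in> Y \<times> U \<Longrightarrow> \<bar>q i z\<bar> \<le> 1"
  shows "rho_E q M \<gamma> (random_occ_set Y U S f \<sigma> T y) \<le> ennreal 2"
proof -
  have "space \<gamma> = Y \<times> U" "prob_space \<gamma>"
    using \<gamma> sets_eq_imp_space_eq[of \<gamma> BK]
    by (auto simp: borel_prob_measures_def space_restrict_space)
  then obtain u where "u \<in> U" using prob_space.not_empty by blast
  from rho_E_le[OF \<gamma> const_control_plan[OF this] y T q, where j=0 and \<beta>=0] show ?thesis by simp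
qed

end

theorem theorem4p2:
  fixes Y :: "(real ^ 'm) set"
    and U :: "'u::metric_space set"
    and S :: "'s::metric_space set"
    and f :: "(real ^ 'm) \<times> 'u \<times> 's \<Rightarrow> real ^ 'm"
    and M :: "'w measure"
    and \<sigma> :: "nat \<Rightarrow> 'w \<Rightarrow> 's"
    and q :: "nat \<Rightarrow> (real ^ 'm) \<times> 'u \<Rightarrow> real"
    and V :: "nat \<Rightarrow> (nat \<Rightarrow> real) set"
  assumes "compact Y" and "compact U" and "compact S"
    and "continuous_on (Y \<times> U \<times> S) f"
    and "\<And>y u s. y \<in> Y \<Longrightarrow> u \<in> U \<Longrightarrow> s \<in> S \<Longrightarrow> f (y, u, s) \<in> Y"
    and "prob_space M"
    and "prob_space.indep_vars M (\<lambda>_. restrict_space borel S) \<sigma> UNIV"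
    and "\<And>t. distr M (restrict_space borel S) (\<sigma> t) = distr M (restrict_space borel S) (\<sigma> 0)"
    and "lipschitz_dense_in_unit_ball (Y \<times> U) q"
    and "\<And>j. j \<ge> 1 \<Longrightarrow> strong_h_approximation Y U S f M \<sigma> j (q_vec q j)"
    and "\<And>j. j \<ge> 1 \<Longrightarrow> compactin (Euclidean_space j) (V j) \<and> convex_vectors (V j)"
    and "\<And>j. j \<ge> 1 \<Longrightarrow> \<exists>\<nu>' :: nat \<Rightarrow> real. \<nu>' \<longlonglongrightarrow> 0 \<and>
           (\<forall>y0\<in>Y. \<forall>T\<ge>1. hausdorff_distance j (V_h Y U S f M \<sigma> (q_vec q j) T y0) (V j)
                            \<le> ennreal (\<nu>' T))"
  shows "\<exists>\<nu> :: nat \<Rightarrow> real. \<nu> \<longlonglongrightarrow> 0 \<and>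
           (\<forall>y0\<in>Y. \<forall>T\<ge>1.
              (SUP \<gamma>\<in>Gamma_set (Y \<times> U) q V. rho_E q M \<gamma> (random_occ_set Y U S f \<sigma> T y0))
                \<le> ennreal (\<nu> T))"
proof -
  interpret stochastic_system Y U S f M \<sigma>
    using assms(1-8) unfolding stochastic_system_def stochastic_system_axioms_def
      controlled_system_def by blast
  have q: "uniformly_continuous_on (Y \<times> U) (q i)" "\<And>z. z \<in> Y \<times> U \<Longrightarrow> \<bar>q i z\<bar> \<le> 1" for i
    using assms(9) by (auto simp: lipschitz_dense_in_unit_ball_def intro: lipschitz_on_uniformly_continuous)
  have qm: "q i \<in> borel_measurable BK" for i
    using uniformly_continuous_imp_continuous[OF q(1)] by (rule borel_measurable_continuous_on_restrict)
  \<comment> \<open>The worst case over states and measures is the rate itself. As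
    \<open>enn2real\<close> sends infinity to 0, the bound \<open>F2\<close> is what makes the
    return from \<open>enn2real (F T)\<close> to \<open>F T\<close> legitimate.\<close>
  define F where "F T = (SUP y0\<in>Y. SUP \<gamma>\<in>Gamma_set (Y \<times> U) q V.
    rho_E q M \<gamma> (random_occ_set Y U S f \<sigma> T y0))" for T
  have F2: "F T \<le> ennreal 2" if "T \<ge> 1" for T
    unfolding F_def using that
    by (intro SUP_least rho_E_le_2 qm q(2)) (auto simp: Gamma_set_def)
  have "(\<lambda>T. enn2real (F T)) \<longlonglongrightarrow> 0"
  proof (rule LIMSEQ_I)
    fix \<epsilon> :: real assume \<epsilon>: "\<epsilon> > 0"
    obtain T0 where T0: "\<And>T \<gamma> y0. T \<ge> T0 \<Longrightarrow> \<gamma> \<in> Gamma_set (Y \<times> U) q V \<Longrightarrow> y0 \<in> Y \<Longrightarrow>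
        rho_E q M \<gamma> (random_occ_set Y U S f \<sigma> T y0) \<le> ennreal (\<epsilon> / 2)"
      using uniform_approximation[of q V "\<epsilon> / 2", OF q assms(12)] \<epsilon> by auto
    show "\<exists>T0. \<forall>T\<ge>T0. norm (enn2real (F T) - 0) < \<epsilon>"
    proof (intro exI[of _ T0] allI impI)
      fix T assume "T \<ge> T0"
      then have "F T \<le> ennreal (\<epsilon> / 2)" unfolding F_def by (intro SUP_least T0)
      then have "enn2real (F T) \<le> \<epsilon> / 2" using \<epsilon> by (intro enn2real_leI) auto
      then show "norm (enn2real (F T) - 0) < \<epsilon>" using \<epsilon> by simp
    qed
  qed
  moreover have "(SUP \<gamma>\<in>Gamma_set (Y \<times> U) q V. rho_E q M \<gamma> (random_occ_set Y U S f \<sigma> T y0))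
      \<le> ennreal (enn2real (F T))" if "y0 \<in> Y" "T \<ge> 1" for y0 T
  proof -
    have "F T < top" using F2[OF that(2)] by (simp add: order_le_less_trans)
    then have "ennreal (enn2real (F T)) = F T" by simp
    moreover have "(SUP \<gamma>\<in>Gamma_set (Y \<times> U) q V. rho_E q M \<gamma> (random_occ_set Y U S f \<sigma> T y0)) \<le> F T"
      unfolding F_def using that(1) by (rule SUP_upper)
    ultimately show ?thesis by simp
  qed
  ultimately show ?thesis by (intro exI[of _ "\<lambda>T. enn2real (F T)"]) auto
qed

end
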